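(* Let $B$ denote the countable universal bipartite graph. (i) Let $\Gamma$ be a countable graph. Then there exist $2^{\aleph_0}$ distinct regular $\mathscr{D}$-classes of $\operatorname{End} B$ whose group $\mathscr{H}$-classes are isomorphic to $\operatorname{Aut}\Gamma$. (ii) Let $f$ be an idempotent endomorphism of $B$ whose image is not isomorphic to the finite complete bipartite graph $K_{1,1}$. Then the $\mathscr{D}$-class of $f$ in $\operatorname{End} B$ contains $2^{\aleph_0}$ distinct group $\mathscr{H}$-classes. (iii) There is a single $\mathscr{D}$-class of $\operatorname{End} B$ containing the idempotent endomorphisms with image isomorphic to $K_{1,1}$. This $\mathscr{D}$-class contains precisely $\aleph_0$ group $\mathscr{H}$-classes, each of which is isomorphic to the cyclic group of order $2$.
   Context: A graph is a pair $(V,E)$ with $E$ an irreflexive symmetric binary relation on $V$. A bipartite graph is a relational structure $(V,E,P)$ where $E$ is an irreflexive symmetric binary relation on $V$, $P=(V_0\times V_0)\cup(V_1\times V_1)$ for some partition $V=V_0\,\dot\cup\,V_1$, and $(u,v)\in E$ implies $(u,v)\notin P$. A homomorphism of bipartite graphs is a map on vertices preserving both $E$ and $P$; isomorphisms and automorphisms are bijections whose inverses are also homomorphisms (they may interchange the parts). The countable universal bipartite graph $B$ is the Fraïssé limit of the class of finite bipartite graphs in this sense (the unique countable existentially closed one). $\operatorname{End} B$ is its endomorphism monoid, maps written on the right. The image of an endomorphism $f$ of $B=(V,E,P)$ is the bipartite graph $(Vf,Ef,P\cap(Vf\times Vf))$. $K_{1,1}$ is the bipartite graph with one vertex in each part joined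 by an edge. Green's relations on a monoid $M$: $f\,\mathscr{L}\,g$ iff $Mf=Mg$; $f\,\mathscr{R}\,g$ iff $fM=gM$; $\mathscr{H}=\mathscr{L}\cap\mathscr{R}$; $\mathscr{D}=\mathscr{L}\circ\mathscr{R}$. An element $f$ is regular if $fgf=f$ for some $g\in M$; a regular $\mathscr{D}$-class consists of regular elements. A group $\mathscr{H}$-class is the $\mathscr{H}$-class of an idempotent. *)

theory Defs
  imports "HOL-Library.Countable_Set" "HOL-Library.Equipollence" "HOL-Library.FuncSet"
    "HOL-Algebra.Group" "HOL-Algebra.Bij" "HOL-Algebra.Elementary_Groups"
begin

section \<open>Graphs and bipartite graphs\<close>

definition graph :: "'a set \<Rightarrow> ('a \<times> 'a) set \<Rightarrow> bool" where
  "graph V E \<longleftrightarrow> E \<subseteq> V \<times> V \<and> irrefl E \<and> sym E"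

text \<open>In all monoids of maps below, maps are written on the right: the product of
  \<open>f\<close> and \<open>g\<close> is ``first \<open>f\<close>, then \<open>g\<close>''.  Maps are extensional outside the vertex set.\<close>

definition Aut_graph :: "'a set \<Rightarrow> ('a \<times> 'a) set \<Rightarrow> ('a \<Rightarrow> 'a) monoid" where
  "Aut_graph V E =
    \<lparr>carrier = {f \<in> Bij V. \<forall>u\<in>V. \<forall>v\<in>V. (u, v) \<in> E \<longleftrightarrow> (f u, f v) \<in> E},
     mult = (\<lambda>f g. compose V g f),
     one = (\<lambda>x\<in>V. x)\<rparr>"

record 'a bgraph =
  bverts :: "'a set"
  bedges :: "('a \<times> 'a) set"
  bpart :: "('a \<times> 'a) set"

text \<open>The parts \<open>V0\<close>, \<open>V1\<close> may be empty; otherwise the class of finite bipartite graphs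
  would not be closed under induced substructures.\<close>

definition bipartite_graph :: "'a bgraph \<Rightarrow> bool" where
  "bipartite_graph B \<longleftrightarrow>
     graph (bverts B) (bedges B) \<and>
     (\<exists>V0 V1. V0 \<union> V1 = bverts B \<and> V0 \<inter> V1 = {} \<and> bpart B = V0 \<times> V0 \<union> V1 \<times> V1) \<and>
     (\<forall>u v. (u, v) \<in> bedges B \<longrightarrow> (u, v) \<notin> bpart B)"

definition bg_hom :: "'a bgraph \<Rightarrow> 'b bgraph \<Rightarrow> ('a \<Rightarrow> 'b) \<Rightarrow> bool" where
  "bg_hom A B f \<longleftrightarrow>
     f \<in> bverts A \<rightarrow> bverts B \<and>
     (\<forall>u v. (u, v) \<in> bedges A \<longrightarrow> (f u, f v) \<in> bedges B) \<and>
     (\<forall>u v. (u, v) \<in> bpart A \<longrightarrow> (f u, f v) \<in> bpart B)"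

definition bg_iso :: "'a bgraph \<Rightarrow> 'b bgraph \<Rightarrow> ('a \<Rightarrow> 'b) \<Rightarrow> bool" where
  "bg_iso A B f \<longleftrightarrow>
     bij_betw f (bverts A) (bverts B) \<and> bg_hom A B f \<and> bg_hom B A (inv_into (bverts A) f)"

definition bg_isomorphic :: "'a bgraph \<Rightarrow> 'b bgraph \<Rightarrow> bool" where
  "bg_isomorphic A B \<longleftrightarrow> (\<exists>f. bg_iso A B f)"

definition bg_induced :: "'a bgraph \<Rightarrow> 'a set \<Rightarrow> 'a bgraph" where
  "bg_induced B U = \<lparr>bverts = U, bedges = bedges B \<inter> U \<times> U, bpart = bpart B \<inter> U \<times> U\<rparr>"

definition bg_embedding :: "'a bgraph \<Rightarrow> 'b bgraph \<Rightarrow> ('a \<Rightarrow> 'b) \<Rightarrow> bool" where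
  "bg_embedding A B f \<longleftrightarrow>
     f ` bverts A \<subseteq> bverts B \<and> bg_iso A (bg_induced B (f ` bverts A)) f"

text \<open>The Fraisse limit of the class of finite bipartite graphs: countable, with age
  exactly that class, and homogeneous.  Finite induced substructures of a bipartite graph are
  bipartite, so the age condition reduces to embedding every finite bipartite graph, and it
  suffices to consider those with vertices in \<open>nat\<close>.\<close>

definition universal_bipartite_graph :: "'a bgraph \<Rightarrow> bool" where
  "universal_bipartite_graph B \<longleftrightarrow>
     bipartite_graph B \<and>
     countable (bverts B) \<and>
     (\<forall>A :: nat bgraph. bipartite_graph A \<and> finite (bverts A) \<longrightarrow> (\<exists>f. bg_embedding A B f)) \<and>
     (\<forall>U W f. finite U \<and> U \<subseteq> bverts B \<and> finite W \<and> W \<subseteq> bverts B \<and>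
        bg_iso (bg_induced B U) (bg_induced B W) f \<longrightarrow>
        (\<exists>g. bg_iso B B g \<and> (\<forall>u\<in>U. g u = f u)))"

definition bg_End :: "'a bgraph \<Rightarrow> ('a \<Rightarrow> 'a) monoid" where
  "bg_End B =
    \<lparr>carrier = {f \<in> extensional (bverts B). bg_hom B B f},
     mult = (\<lambda>f g. compose (bverts B) g f),
     one = (\<lambda>x\<in>bverts B. x)\<rparr>"

definition bg_image :: "'a bgraph \<Rightarrow> ('a \<Rightarrow> 'a) \<Rightarrow> 'a bgraph" where
  "bg_image B f =
    \<lparr>bverts = f ` bverts B,
     bedges = map_prod f f ` bedges B,
     bpart = bpart B \<inter> (f ` bverts B) \<times> (f ` bverts B)\<rparr>"

definition K11 :: "bool bgraph" where
  "K11 = \<lparr>bverts = UNIV, bedges = {(False, True), (True, False)},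
          bpart = {(False, False), (True, True)}\<rparr>"

section \<open>Green's relations\<close>

definition green_L :: "('a, 'b) monoid_scheme \<Rightarrow> ('a \<times> 'a) set" where
  "green_L M = {(f, g). f \<in> carrier M \<and> g \<in> carrier M \<and>
     (\<lambda>m. m \<otimes>\<^bsub>M\<^esub> f) ` carrier M = (\<lambda>m. m \<otimes>\<^bsub>M\<^esub> g) ` carrier M}"

definition green_R :: "('a, 'b) monoid_scheme \<Rightarrow> ('a \<times> 'a) set" where
  "green_R M = {(f, g). f \<in> carrier M \<and> g \<in> carrier M \<and>
     (\<lambda>m. f \<otimes>\<^bsub>M\<^esub> m) ` carrier M = (\<lambda>m. g \<otimes>\<^bsub>M\<^esub> m) ` carrier M}"

definition green_H :: "('a, 'b) monoid_scheme \<Rightarrow> ('a \<times> 'a) set" where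
  "green_H M = green_L M \<inter> green_R M"

definition green_D :: "('a, 'b) monoid_scheme \<Rightarrow> ('a \<times> 'a) set" where
  "green_D M = green_L M O green_R M"

definition D_classes :: "('a, 'b) monoid_scheme \<Rightarrow> 'a set set" where
  "D_classes M = carrier M // green_D M"

definition idempotents :: "('a, 'b) monoid_scheme \<Rightarrow> 'a set" where
  "idempotents M = {e \<in> carrier M. e \<otimes>\<^bsub>M\<^esub> e = e}"

definition regular_elements :: "('a, 'b) monoid_scheme \<Rightarrow> 'a set" where
  "regular_elements M = {f \<in> carrier M. \<exists>g \<in> carrier M. f \<otimes>\<^bsub>M\<^esub> g \<otimes>\<^bsub>M\<^esub> f = f}"

definition regular_D_classes :: "('a, 'b) monoid_scheme \<Rightarrow> 'a set set" where
  "regular_D_classes M = {D \<in> D_classes M. D \<subseteq> regular_elements M}"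

definition group_H_classes_in :: "('a, 'b) monoid_scheme \<Rightarrow> 'a set \<Rightarrow> 'a set set" where
  "group_H_classes_in M D = {H. H \<subseteq> D \<and> (\<exists>e \<in> idempotents M. H = green_H M `` {e})}"

text \<open>A group \<open>\<H>\<close>-class contains exactly one idempotent, which is its identity.\<close>

definition H_class_group :: "('a, 'b) monoid_scheme \<Rightarrow> 'a set \<Rightarrow> 'a monoid" where
  "H_class_group M H =
    \<lparr>carrier = H, mult = mult M, one = (THE e. e \<in> H \<and> e \<in> idempotents M)\<rparr>"

end

theory Submission
  imports Defs
begin

text \<open>
  The image of an idempotent endomorphism of \<open>B\<close> is an induced subgraph in which every finite set of
  vertices of one colour has a common neighbour.  Conversely, every countable bipartite graph with this
  property is such an image: embed it in \<open>B\<close> so sparsely that each outside vertex has only finitely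
  many neighbours in it, and map the outside vertices into it one by one.  Idempotents are
  \<open>\<D>\<close>-related iff their images are isomorphic, and the \<open>\<H>\<close>-class of an idempotent is the
  automorphism group of its image; hence (i) asks for continuum many pairwise non-isomorphic images
  with automorphism group \<open>Aut \<Gamma>\<close>.  For (ii), isolated vertices added to the embedded image can be
  retracted in two ways each as soon as the image has two vertices of one colour, that is, unless it
  is \<open>K\<^sub>1\<^sub>,\<^sub>1\<close>.  For (iii), the idempotents with image \<open>K\<^sub>1\<^sub>,\<^sub>1\<close> correspond to the edges of \<open>B\<close>.
\<close>

section \<open>Green's relations\<close>

text \<open>Domination is what building a retraction consumes: an outside vertex must go to a common
  neighbour of the finitely many vertices already assigned to its neighbours, and these all have one
  colour. This shapes the coding behind (i). An ordinary incidence graph fails, since finitely many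
  points need not lie in a common block. With edges meaning non-membership, the empty block is
  joined to all points, and any finitely many blocks miss a common point because each of them
  contains only finitely many naturals congruent to 2 modulo 3. The second obstacle is that
  endomorphisms and isomorphisms may interchange the parts. Idempotents cannot, so they respect a
  fixed colouring \<open>c\<close>; but the coding graph must be built so that no isomorphism
  exchanges points with blocks, or its automorphism group could be larger than that of the coded
  graph. In (iii) the interchange is exactly what supplies the nontrivial automorphism of
  \<open>K11\<close>. The upper bounds in (i) and (ii) come from the countability of
  \<open>B\<close>, which bounds the size of \<open>bg_End B\<close> itself.\<close>

context monoid
begin

lemma green_L_iff:
  "(f, g) \<in> green_L G \<longleftrightarrow> f \<in> carrier G \<and> g \<in> carrier G \<and>
     (\<exists>a\<in>carrier G. f = a \<otimes> g) \<and> (\<exists>b\<in>carrier G. g = b \<otimes> f)" (is "?l \<longleftrightarrow> ?r")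
proof
  assume ?l
  then have fg: "f \<in> carrier G" "g \<in> carrier G"
    and eq: "(\<lambda>m. m \<otimes> f) ` carrier G = (\<lambda>m. m \<otimes> g) ` carrier G"
    by (auto simp: green_L_def)
  have "\<one> \<otimes> f \<in> (\<lambda>m. m \<otimes> f) ` carrier G" "\<one> \<otimes> g \<in> (\<lambda>m. m \<otimes> g) ` carrier G" by auto
  then have "f \<in> (\<lambda>m. m \<otimes> g) ` carrier G" "g \<in> (\<lambda>m. m \<otimes> f) ` carrier G" using fg eq by auto
  then show ?r using fg by auto
next
  have sub: "(\<lambda>m. m \<otimes> x) ` carrier G \<subseteq> (\<lambda>m. m \<otimes> y) ` carrier G"
    if "x = a \<otimes> y" "a \<in> carrier G" "y \<in> carrier G" for x a y
    using that by (auto simp: image_iff m_assoc [symmetric])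
  assume ?r
  then obtain a b where "f \<in> carrier G" "g \<in> carrier G" "a \<in> carrier G" "b \<in> carrier G"
    and "f = a \<otimes> g" "g = b \<otimes> f" by blast
  then show ?l using sub [of f a g] sub [of g b f] unfolding green_L_def by blast
qed

lemma green_R_iff:
  "(f, g) \<in> green_R G \<longleftrightarrow> f \<in> carrier G \<and> g \<in> carrier G \<and>
     (\<exists>a\<in>carrier G. f = g \<otimes> a) \<and> (\<exists>b\<in>carrier G. g = f \<otimes> b)" (is "?l \<longleftrightarrow> ?r")
proof
  assume ?l
  then have fg: "f \<in> carrier G" "g \<in> carrier G"
    and eq: "(\<lambda>m. f \<otimes> m) ` carrier G = (\<lambda>m. g \<otimes> m) ` carrier G"
    by (auto simp: green_R_def)
  have "f \<otimes> \<one> \<in> (\<lambda>m. f \<otimes> m) ` carrier G" "g \<otimes> \<one> \<in> (\<lambda>m. g \<otimes> m) ` carrier G" by auto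
  then have "f \<in> (\<lambda>m. g \<otimes> m) ` carrier G" "g \<in> (\<lambda>m. f \<otimes> m) ` carrier G" using fg eq by auto
  then show ?r using fg by auto
next
  have sub: "(\<lambda>m. x \<otimes> m) ` carrier G \<subseteq> (\<lambda>m. y \<otimes> m) ` carrier G"
    if "x = y \<otimes> a" "a \<in> carrier G" "y \<in> carrier G" for x a y
    using that by (auto simp: image_iff m_assoc)
  assume ?r
  then obtain a b where "f \<in> carrier G" "g \<in> carrier G" "a \<in> carrier G" "b \<in> carrier G"
    and "f = g \<otimes> a" "g = f \<otimes> b" by blast
  then show ?l using sub [of f g a] sub [of g f b] unfolding green_R_def by blast
qed

lemma equiv_green_L: "equiv (carrier G) (green_L G)"
  by (intro equivI) (auto simp: green_L_def refl_on_def sym_def trans_def)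

lemma equiv_green_R: "equiv (carrier G) (green_R G)"
  by (intro equivI) (auto simp: green_R_def refl_on_def sym_def trans_def)

lemma equiv_green_H: "equiv (carrier G) (green_H G)"
  by (intro equivI) (auto simp: green_H_def green_L_def green_R_def refl_on_def sym_def trans_def)

text \<open>The egg-box argument: if \<open>h = f \<otimes> m\<close> and
  \<open>k = a \<otimes> f\<close>, then \<open>a \<otimes> h = k \<otimes> m\<close> is the fourth
  corner, L-related to \<open>h\<close> and R-related to \<open>k\<close>. This inclusion makes
  \<open>green_D\<close> both symmetric and transitive.\<close>

lemma green_R_L_commute: "green_R G O green_L G \<subseteq> green_L G O green_R G"
proof clarify
  fix h f k
  assume "(h, f) \<in> green_R G" "(f, k) \<in> green_L G"
  then obtain m n a b where c: "h \<in> carrier G" "f \<in> carrier G" "k \<in> carrier G"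
      "m \<in> carrier G" "n \<in> carrier G" "a \<in> carrier G" "b \<in> carrier G"
    and e: "h = f \<otimes> m" "f = h \<otimes> n" "k = a \<otimes> f" "f = b \<otimes> k"
    unfolding green_L_iff green_R_iff by metis
  have z: "a \<otimes> h = k \<otimes> m" using c e by (metis m_assoc)
  have "(h, a \<otimes> h) \<in> green_L G" unfolding green_L_iff
    using c e z by (metis m_assoc m_closed)
  moreover have "(a \<otimes> h, k) \<in> green_R G" unfolding green_R_iff
    using c e z by (metis m_assoc m_closed)
  ultimately show "(h, k) \<in> green_L G O green_R G" by blast
qed

lemma equiv_green_D: "equiv (carrier G) (green_D G)"
proof (rule equivI)
  show "green_D G \<subseteq> carrier G \<times> carrier G"
    by (auto simp: green_D_def green_L_def green_R_def)
  show "refl_on (carrier G) (green_D G)"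
    using equiv_green_L equiv_green_R unfolding green_D_def equiv_def refl_on_def by blast
  show "sym (green_D G)"
    using equiv_green_L equiv_green_R green_R_L_commute unfolding green_D_def equiv_def sym_def by blast
  have "green_D G O green_D G \<subseteq> green_D G"
  proof -
    have "green_D G O green_D G = green_L G O (green_R G O green_L G) O green_R G"
      by (simp add: green_D_def O_assoc)
    also have "\<dots> \<subseteq> green_L G O (green_L G O green_R G) O green_R G"
      using green_R_L_commute by blast
    also have "\<dots> \<subseteq> green_D G"
      using equiv_green_L equiv_green_R unfolding green_D_def equiv_def trans_def by blast
    finally show ?thesis .
  qed
  then show "trans (green_D G)" by (auto simp: trans_def)
qed

lemma green_H_subset_green_D: "green_H G \<subseteq> green_D G"
  using equiv_green_R unfolding green_H_def green_D_def green_L_def equiv_def refl_on_def by fastforce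

text \<open>This form is usable for maps: \<open>x\<close> and \<open>y\<close> will restrict to
  mutually inverse maps between the images of \<open>e\<close> and \<open>f\<close>. The element
  \<open>h\<close> linking \<open>e\<close> to \<open>f\<close> in \<open>green_D\<close> serves as
  \<open>y\<close>, and \<open>e \<otimes> b \<otimes> f\<close> serves as \<open>x\<close>, where
  \<open>e = b \<otimes> h\<close>.\<close>

lemma green_D_idempotents_iff:
  assumes "e \<in> idempotents G" "f \<in> idempotents G"
  shows "(e, f) \<in> green_D G \<longleftrightarrow> (\<exists>x\<in>carrier G. \<exists>y\<in>carrier G. x \<otimes> y = e \<and> y \<otimes> x = f)"
proof
  have i: "e \<in> carrier G" "f \<in> carrier G" "e \<otimes> e = e" "f \<otimes> f = f"
    using assms by (auto simp: idempotents_def)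
  assume "(e, f) \<in> green_D G"
  then obtain h a b m n where c: "h \<in> carrier G" "a \<in> carrier G" "b \<in> carrier G"
      "m \<in> carrier G" "n \<in> carrier G"
    and e: "h = a \<otimes> e" "e = b \<otimes> h" "h = f \<otimes> m" "f = h \<otimes> n"
    unfolding green_D_def relcomp_unfold green_L_iff green_R_iff by blast
  have he: "h \<otimes> e = h" and fh: "f \<otimes> h = h" using c e i by (metis m_assoc)+
  have "(e \<otimes> b \<otimes> f) \<otimes> h = e" using c i he fh e by (metis m_assoc m_closed)
  moreover have "h \<otimes> (e \<otimes> b \<otimes> f) = h \<otimes> b \<otimes> (h \<otimes> n)"
    using c i he e(4) by (simp add: m_assoc [symmetric])
  moreover have "\<dots> = h \<otimes> (b \<otimes> h) \<otimes> n" using c by (simp add: m_assoc)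
  moreover have "\<dots> = f" using e(2,4) he by metis
  ultimately show "\<exists>x\<in>carrier G. \<exists>y\<in>carrier G. x \<otimes> y = e \<and> y \<otimes> x = f"
    using c i by (metis m_closed)
next
  have i: "e \<in> carrier G" "f \<in> carrier G" "e \<otimes> e = e" "f \<otimes> f = f"
    using assms by (auto simp: idempotents_def)
  assume "\<exists>x\<in>carrier G. \<exists>y\<in>carrier G. x \<otimes> y = e \<and> y \<otimes> x = f"
  then obtain x y where c: "x \<in> carrier G" "y \<in> carrier G" and e: "x \<otimes> y = e" "y \<otimes> x = f" by blast
  have h: "y \<otimes> e = f \<otimes> y" using c e by (metis m_assoc)
  have "(e, y \<otimes> e) \<in> green_L G" unfolding green_L_iff
    using c i e by (metis m_assoc m_closed)
  moreover have "(y \<otimes> e, f) \<in> green_R G" unfolding green_R_iff h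
    using c i e by (metis m_assoc m_closed)
  ultimately show "(e, f) \<in> green_D G" unfolding green_D_def by blast
qed

text \<open>If \<open>h\<close> links \<open>e\<close> to \<open>g\<close>, with
  \<open>e = b \<otimes> h\<close> and \<open>h = g \<otimes> m\<close>, then
  \<open>m \<otimes> b\<close> is a generalised inverse of \<open>g\<close>, because
  \<open>h \<otimes> b \<otimes> h = h \<otimes> e = h\<close>.\<close>

lemma green_D_idempotent_regular:
  assumes "e \<in> idempotents G"
  shows "green_D G `` {e} \<subseteq> regular_elements G"
proof
  fix g
  have i: "e \<in> carrier G" "e \<otimes> e = e"
    using assms by (auto simp: idempotents_def)
  assume "g \<in> green_D G `` {e}"
  then obtain h a b m n where c: "h \<in> carrier G" "a \<in> carrier G" "b \<in> carrier G"
      "m \<in> carrier G" "n \<in> carrier G" "g \<in> carrier G"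
    and e: "h = a \<otimes> e" "e = b \<otimes> h" "h = g \<otimes> m" "g = h \<otimes> n"
    unfolding green_D_def relcomp_unfold Image_singleton_iff mem_Collect_eq prod.case
      green_L_iff green_R_iff by blast
  have he: "h \<otimes> (b \<otimes> h) = h" using c e i by (metis m_assoc)
  have "g \<otimes> (m \<otimes> b) \<otimes> g = h \<otimes> b \<otimes> (h \<otimes> n)" using c e(3,4) by (metis m_assoc)
  also have "\<dots> = h \<otimes> (b \<otimes> h) \<otimes> n" using c by (simp add: m_assoc)
  also have "\<dots> = g" using he e(4) by metis
  finally show "g \<in> regular_elements G" using c unfolding regular_elements_def by blast
qed

text \<open>An idempotent is a right identity on its L-class and a left identity on its R-class, so
  \<open>e \<otimes> f\<close> equals both \<open>e\<close> and \<open>f\<close>.\<close>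

lemma green_H_idempotents_eq:
  assumes "e \<in> idempotents G" "f \<in> idempotents G" "(e, f) \<in> green_H G"
  shows "e = f"
proof -
  have i: "e \<in> carrier G" "f \<in> carrier G" "e \<otimes> e = e" "f \<otimes> f = f"
    using assms by (auto simp: idempotents_def)
  obtain b m where c: "b \<in> carrier G" "m \<in> carrier G" "e = b \<otimes> f" "f = e \<otimes> m"
    using assms(3) unfolding green_H_def Int_iff green_L_iff green_R_iff by blast
  have "e \<otimes> f = e" using c i by (metis m_assoc)
  moreover have "e \<otimes> f = f" using c i by (metis m_assoc)
  ultimately show ?thesis by simp
qed

text \<open>The right-hand side says that \<open>h\<close> is a unit, with inverse \<open>k\<close>,
  of the local monoid of all elements for which \<open>e\<close> is a two-sided identity. The class
  of \<open>e\<close> is thus the unit group of that local monoid.\<close>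

lemma green_H_idempotent_iff:
  assumes "e \<in> idempotents G"
  shows "(e, h) \<in> green_H G \<longleftrightarrow> h \<in> carrier G \<and> e \<otimes> h = h \<and> h \<otimes> e = h \<and>
    (\<exists>k\<in>carrier G. e \<otimes> k = k \<and> k \<otimes> e = k \<and> h \<otimes> k = e \<and> k \<otimes> h = e)" (is "?l \<longleftrightarrow> ?r")
proof
  have i: "e \<in> carrier G" "e \<otimes> e = e" using assms by (auto simp: idempotents_def)
  assume ?l
  then obtain a b m n where c: "h \<in> carrier G" "a \<in> carrier G" "b \<in> carrier G"
      "m \<in> carrier G" "n \<in> carrier G"
    and e: "h = a \<otimes> e" "e = b \<otimes> h" "h = e \<otimes> m" "e = h \<otimes> n"
    unfolding green_H_def Int_iff green_L_iff green_R_iff by blast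
  have he: "h \<otimes> e = h" using c(2) i unfolding e(1) by (simp add: m_assoc)
  have eh: "e \<otimes> h = h" using c(4) i unfolding e(3) by (simp add: m_assoc [symmetric])
  \<comment> \<open>The multiplier \<open>b\<close> need not lie in the local monoid at
    \<open>e\<close>; multiplying it by \<open>e\<close> on both sides puts it there and turns it
    into a two-sided inverse of \<open>h\<close>.\<close>
  let ?k = "e \<otimes> b \<otimes> e"
  have "?k \<otimes> h = e \<otimes> (b \<otimes> (e \<otimes> h))" using c i by (simp add: m_assoc)
  then have kh: "?k \<otimes> h = e" unfolding eh e(2) [symmetric] i .
  have "h \<otimes> ?k = (h \<otimes> e) \<otimes> (b \<otimes> e)" using c i by (simp add: m_assoc)
  also have "\<dots> = h \<otimes> (b \<otimes> (h \<otimes> n))" unfolding he e(4) [symmetric] ..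
  also have "\<dots> = h \<otimes> (b \<otimes> h) \<otimes> n" using c by (simp add: m_assoc)
  also have "\<dots> = e" unfolding e(2) [symmetric] he e(4) [symmetric] ..
  finally have hk: "h \<otimes> ?k = e" .
  have "e \<otimes> ?k = (e \<otimes> e) \<otimes> b \<otimes> e" "?k \<otimes> e = e \<otimes> b \<otimes> (e \<otimes> e)" using c i(1) by (simp_all add: m_assoc)
  then have "e \<otimes> ?k = ?k" "?k \<otimes> e = ?k" unfolding i(2) .
  then show ?r using c i he eh kh hk by (intro conjI bexI [of _ ?k]) auto
next
  assume ?r
  then obtain k where k: "h \<in> carrier G" "k \<in> carrier G" "e = h \<otimes> k" "e = k \<otimes> h"
    "h = e \<otimes> h" "h = h \<otimes> e" by metis
  have "e \<in> carrier G" using assms by (simp add: idempotents_def)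
  then show ?l using k unfolding green_H_def Int_iff green_L_iff green_R_iff by blast
qed

lemma green_H_class_inj_on: "inj_on (\<lambda>e. green_H G `` {e}) (idempotents G)"
proof (rule inj_onI)
  fix e f assume e: "e \<in> idempotents G" "f \<in> idempotents G" "green_H G `` {e} = green_H G `` {f}"
  have "(e, f) \<in> green_H G"
    using e(2,3) by (intro eq_equiv_class [OF e(3) equiv_green_H]) (simp add: idempotents_def)
  then show "e = f" using e green_H_idempotents_eq by blast
qed

text \<open>Reduces every count of group H-classes to a count of idempotents: each such class holds
  exactly one, and an H-class lies inside a single D-class.\<close>

lemma group_H_classes_in_green_D:
  assumes "a \<in> carrier G"
  shows "group_H_classes_in G (green_D G `` {a}) \<approx> {e \<in> idempotents G. (a, e) \<in> green_D G}"
proof -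
  have "group_H_classes_in G (green_D G `` {a}) =
    (\<lambda>e. green_H G `` {e}) ` {e \<in> idempotents G. (a, e) \<in> green_D G}" (is "_ = ?im")
  proof safe
    fix H assume "H \<in> group_H_classes_in G (green_D G `` {a})"
    then obtain e where e: "e \<in> idempotents G" "H = green_H G `` {e}" "H \<subseteq> green_D G `` {a}"
      by (auto simp: group_H_classes_in_def)
    have "e \<in> H" using e equiv_class_self [OF equiv_green_H] by (simp add: idempotents_def)
    then show "H \<in> ?im" using e by auto
  next
    fix e assume e: "e \<in> idempotents G" "(a, e) \<in> green_D G"
    have "green_H G `` {e} \<subseteq> green_D G `` {a}"
      using e green_H_subset_green_D equiv_green_D unfolding equiv_def trans_def by blast
    then show "green_H G `` {e} \<in> group_H_classes_in G (green_D G `` {a})"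
      using e by (auto simp: group_H_classes_in_def)
  qed
  moreover have "inj_on (\<lambda>e. green_H G `` {e}) {e \<in> idempotents G. (a, e) \<in> green_D G}"
    using green_H_class_inj_on by (rule inj_on_subset) auto
  ultimately show ?thesis by (simp add: inj_on_image_eqpoll_self)
qed

end

section \<open>Bipartite graphs\<close>

text \<open>The relation \<open>bpart\<close> only says when two vertices share a part; a colouring
  also names the part, so that a vertex of prescribed colour can be asked for even when there is
  nothing to compare it with.\<close>

lemma bipartite_graph_iff_colouring:
  "bipartite_graph A \<longleftrightarrow> graph (bverts A) (bedges A) \<and>
     (\<exists>c::'a \<Rightarrow> bool. bpart A = {(u, v). u \<in> bverts A \<and> v \<in> bverts A \<and> c u = c v} \<and>
        (\<forall>u v. (u, v) \<in> bedges A \<longrightarrow> c u \<noteq> c v))" (is "?l \<longleftrightarrow> ?r")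
proof
  assume l: ?l
  then obtain V0 V1 where V: "V0 \<union> V1 = bverts A" "V0 \<inter> V1 = {}" "bpart A = V0 \<times> V0 \<union> V1 \<times> V1"
    by (auto simp: bipartite_graph_def)
  have g: "graph (bverts A) (bedges A)" and np: "\<forall>u v. (u, v) \<in> bedges A \<longrightarrow> (u, v) \<notin> bpart A"
    using l by (auto simp: bipartite_graph_def)
  have p: "bpart A = {(u, v). u \<in> bverts A \<and> v \<in> bverts A \<and> (u \<in> V0) = (v \<in> V0)}"
    using V by auto
  moreover have "\<forall>u v. (u, v) \<in> bedges A \<longrightarrow> (u \<in> V0) \<noteq> (v \<in> V0)"
    using g np unfolding p graph_def by auto
  ultimately show ?r using g by (intro conjI exI [of _ "\<lambda>v. v \<in> V0"]) auto
next
  assume ?r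
  then obtain c :: "'a \<Rightarrow> bool" where c: "graph (bverts A) (bedges A)"
    "bpart A = {(u, v). u \<in> bverts A \<and> v \<in> bverts A \<and> c u = c v}"
    "\<forall>u v. (u, v) \<in> bedges A \<longrightarrow> c u \<noteq> c v" by blast
  have "bpart A = {v \<in> bverts A. c v} \<times> {v \<in> bverts A. c v} \<union> {v \<in> bverts A. \<not> c v} \<times> {v \<in> bverts A. \<not> c v}"
    using c(2) by auto
  moreover have "{v \<in> bverts A. c v} \<union> {v \<in> bverts A. \<not> c v} = bverts A"
    "{v \<in> bverts A. c v} \<inter> {v \<in> bverts A. \<not> c v} = {}" by auto
  moreover have "\<forall>u v. (u, v) \<in> bedges A \<longrightarrow> (u, v) \<notin> bpart A" using c by auto
  ultimately show ?l using c(1) unfolding bipartite_graph_def by blast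
qed

lemma bipartite_graph_subsets:
  assumes "bipartite_graph A"
  shows "bedges A \<subseteq> bverts A \<times> bverts A" "bpart A \<subseteq> bverts A \<times> bverts A"
  using assms by (auto simp: bipartite_graph_def graph_def)

text \<open>Both relations live on the vertex sets, so preservation by the inverse map can be traded
  for reflection by \<open>f\<close> itself.\<close>

lemma bg_iso_iff:
  assumes A: "bipartite_graph A" and C: "bipartite_graph C"
  shows "bg_iso A C f \<longleftrightarrow> bij_betw f (bverts A) (bverts C) \<and>
    (\<forall>u\<in>bverts A. \<forall>v\<in>bverts A. ((f u, f v) \<in> bedges C \<longleftrightarrow> (u, v) \<in> bedges A) \<and>
       ((f u, f v) \<in> bpart C \<longleftrightarrow> (u, v) \<in> bpart A))" (is "?l \<longleftrightarrow> ?r")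
proof
  assume l: ?l
  then have b: "bij_betw f (bverts A) (bverts C)" by (simp add: bg_iso_def)
  then have "inv_into (bverts A) f (f u) = u" if "u \<in> bverts A" for u
    using that by (simp add: bij_betw_inv_into_left)
  then show ?r using l unfolding bg_iso_def bg_hom_def by metis
next
  assume r: ?r
  then have b: "bij_betw f (bverts A) (bverts C)" by simp
  have i: "f (inv_into (bverts A) f x) = x" "inv_into (bverts A) f x \<in> bverts A" if "x \<in> bverts C" for x
    using that b by (auto simp: bij_betw_inv_into_right bij_betw_def intro: inv_into_into)
  have "bg_hom A C f"
    using r b bipartite_graph_subsets [OF A] unfolding bg_hom_def by (auto simp: bij_betw_def)
  moreover have "bg_hom C A (inv_into (bverts A) f)"
    unfolding bg_hom_def
  proof (intro conjI allI impI)
    fix x y assume "(x, y) \<in> bedges C"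
    moreover from this have "x \<in> bverts C" "y \<in> bverts C" using bipartite_graph_subsets [OF C] by auto
    ultimately show "(inv_into (bverts A) f x, inv_into (bverts A) f y) \<in> bedges A"
      using r i [of x] i [of y] by metis
  next
    fix x y assume "(x, y) \<in> bpart C"
    moreover from this have "x \<in> bverts C" "y \<in> bverts C" using bipartite_graph_subsets [OF C] by auto
    ultimately show "(inv_into (bverts A) f x, inv_into (bverts A) f y) \<in> bpart A"
      using r i [of x] i [of y] by metis
  qed (use i in auto)
  ultimately show ?l using b by (simp add: bg_iso_def)
qed

lemma bipartite_graph_induced:
  assumes "bipartite_graph B" "U \<subseteq> bverts B"
  shows "bipartite_graph (bg_induced B U)"
proof -
  obtain c :: "'a \<Rightarrow> bool" where c: "graph (bverts B) (bedges B)"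
    "bpart B = {(u, v). u \<in> bverts B \<and> v \<in> bverts B \<and> c u = c v}"
    "\<forall>u v. (u, v) \<in> bedges B \<longrightarrow> c u \<noteq> c v"
    using assms unfolding bipartite_graph_iff_colouring by blast
  show ?thesis unfolding bipartite_graph_iff_colouring bg_induced_def
    by (intro conjI exI [of _ c]) (use c assms(2) in \<open>auto simp: graph_def irrefl_def sym_def\<close>)
qed

lemma bg_isomorphic_sym:
  assumes "bipartite_graph A" "bipartite_graph C" "bg_isomorphic A C"
  shows "bg_isomorphic C A"
proof -
  obtain f where f: "bg_iso A C f" using assms(3) by (auto simp: bg_isomorphic_def)
  then have b: "bij_betw f (bverts A) (bverts C)" by (simp add: bg_iso_def)
  have "f (inv_into (bverts A) f x) = x" "inv_into (bverts A) f x \<in> bverts A" if "x \<in> bverts C" for x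
    using that b by (auto simp: bij_betw_inv_into_right bij_betw_def intro: inv_into_into)
  then have "bg_iso C A (inv_into (bverts A) f)"
    using f bij_betw_inv_into [OF b] unfolding bg_iso_iff [OF assms(1,2)] bg_iso_iff [OF assms(2,1)]
    by metis
  then show ?thesis by (auto simp: bg_isomorphic_def)
qed

lemma bg_isomorphic_trans:
  assumes "bipartite_graph A" "bipartite_graph C" "bipartite_graph D"
    and "bg_isomorphic A C" "bg_isomorphic C D"
  shows "bg_isomorphic A D"
proof -
  obtain f g where fg: "bg_iso A C f" "bg_iso C D g" using assms by (auto simp: bg_isomorphic_def)
  have "bij_betw (g \<circ> f) (bverts A) (bverts D)" using fg bij_betw_trans by (auto simp: bg_iso_def)
  moreover have "f u \<in> bverts C" if "u \<in> bverts A" for u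
    using fg(1) that by (auto simp: bg_iso_def bij_betw_def)
  ultimately have "bg_iso A D (g \<circ> f)"
    using fg unfolding bg_iso_iff [OF assms(1,2)] bg_iso_iff [OF assms(2,3)] bg_iso_iff [OF assms(1,3)]
    by simp
  then show ?thesis by (auto simp: bg_isomorphic_def)
qed

text \<open>The working form of universality: age and homogeneity are replaced by one-point
  extensions, that is, existential closedness. The colour \<open>k\<close> is explicit so that the
  colour of the new vertex is prescribed even for empty \<open>U\<close>; \<open>W\<close> may
  overlap \<open>U\<close> and contain both colours.\<close>

locale universal_bg =
  fixes B :: "'v bgraph" and c :: "'v \<Rightarrow> bool"
  assumes countable_verts: "countable (bverts B)"
    and graph: "graph (bverts B) (bedges B)"
    and part_eq: "bpart B = {(u, v). u \<in> bverts B \<and> v \<in> bverts B \<and> c u = c v}"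
    and edge_colours: "(u, v) \<in> bedges B \<Longrightarrow> c u \<noteq> c v"
    and extension: "\<lbrakk>finite U; finite W; U \<union> W \<subseteq> bverts B; \<forall>u\<in>U. c u = k\<rbrakk> \<Longrightarrow>
      \<exists>v\<in>bverts B - (U \<union> W). c v \<noteq> k \<and> (\<forall>u\<in>U. (v, u) \<in> bedges B) \<and>
        (\<forall>w\<in>W - U. (v, w) \<notin> bedges B)"

text \<open>One-point extensions: realise the extended finite graph somewhere in \<open>B\<close> and move it onto
  the given vertices by homogeneity.  The vertex \<open>w0\<close> pins down the colour of the new vertex,
  which the relation \<open>bpart\<close> determines only relative to other vertices.\<close>

lemma universal_bipartite_graph_extension:
  assumes univ: "universal_bipartite_graph B"
    and part: "bpart B = {(u, v). u \<in> bverts B \<and> v \<in> bverts B \<and> c u = c v}"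
    and col: "\<forall>u v. (u, v) \<in> bedges B \<longrightarrow> c u \<noteq> (c v :: bool)"
    and fin: "finite U" "finite W" "U \<union> W \<subseteq> bverts B" and k: "\<forall>u\<in>U. c u = k"
  shows "\<exists>v\<in>bverts B - (U \<union> W). c v \<noteq> k \<and> (\<forall>u\<in>U. (v, u) \<in> bedges B) \<and>
        (\<forall>w\<in>W - U. (v, w) \<notin> bedges B)"
proof -
  have bip: "bipartite_graph B" and
    emb: "\<And>A :: nat bgraph. bipartite_graph A \<Longrightarrow> finite (bverts A) \<Longrightarrow> \<exists>f. bg_embedding A B f" and
    homog: "\<And>U W f. finite U \<Longrightarrow> U \<subseteq> bverts B \<Longrightarrow> finite W \<Longrightarrow> W \<subseteq> bverts B \<Longrightarrow>
        bg_iso (bg_induced B U) (bg_induced B W) f \<Longrightarrow> \<exists>g. bg_iso B B g \<and> (\<forall>u\<in>U. g u = f u)"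
    using univ unfolding universal_bipartite_graph_def by blast+
  have gr: "bedges B \<subseteq> bverts B \<times> bverts B" "irrefl (bedges B)" "sym (bedges B)"
    using bip by (auto simp: bipartite_graph_def graph_def)
  obtain w0 where w0: "w0 \<in> bverts B"
  proof -
    let ?A = "\<lparr>bverts = {0::nat}, bedges = {}, bpart = {(0, 0)}\<rparr>"
    have "bipartite_graph ?A" unfolding bipartite_graph_iff_colouring
      by (intro conjI exI [of _ "\<lambda>_. True"]) (auto simp: graph_def irrefl_def sym_def)
    then obtain f where "bg_embedding ?A B f" using emb [of ?A] by auto
    then show ?thesis using that by (auto simp: bg_embedding_def)
  qed
  define F where "F = insert w0 (U \<union> W)"
  have F: "finite F" "F \<subseteq> bverts B" using fin w0 by (auto simp: F_def)
  define n where "n = card F"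
  obtain g where g: "bij_betw g {0..<n} F"
    using ex_bij_betw_nat_finite [OF F(1)] by (auto simp: n_def)
  have gF: "g i \<in> F" if "i < n" for i using g that by (auto simp: bij_betw_def)
  \<comment> \<open>Indices below \<open>n\<close> number the vertices of \<open>F\<close>; the
    index \<open>n\<close> is the new vertex, coloured opposite to \<open>k\<close> and joined in
    \<open>EA\<close> exactly to the members of \<open>U\<close>.\<close>
  define d where "d i = (if i < n then c (g i) else \<not> k)" for i
  define EA where "EA = {(i, j). i < n \<and> j < n \<and> (g i, g j) \<in> bedges B} \<union>
    {(i, j). i < n \<and> j = n \<and> g i \<in> U} \<union> {(j, i). i < n \<and> j = n \<and> g i \<in> U}"
  define A where "A = \<lparr>bverts = {..n}, bedges = EA,
     bpart = {(i, j). i \<le> n \<and> j \<le> n \<and> d i = d j}\<rparr>"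
  have A_sel: "bverts A = {..n}" "bedges A = EA" "bpart A = {(i, j). i \<le> n \<and> j \<le> n \<and> d i = d j}"
    by (auto simp: A_def)
  have bipA: "bipartite_graph A" unfolding bipartite_graph_iff_colouring A_sel
  proof (intro conjI exI [of _ d])
    show "Defs.graph {..n} EA"
      using gr unfolding Defs.graph_def EA_def irrefl_def sym_def by auto
    show "\<forall>i j. (i, j) \<in> EA \<longrightarrow> d i \<noteq> d j"
      using col k unfolding EA_def d_def by auto
  qed auto
  obtain f where f: "bg_embedding A B f" using emb [OF bipA] by (auto simp: A_sel)
  have fV: "f i \<in> bverts B" if "i \<le> n" for i using f that by (auto simp: bg_embedding_def A_sel)
  have bf: "bipartite_graph (bg_induced B (f ` {..n}))"
    by (intro bipartite_graph_induced bip) (auto simp: fV)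
  have fi: "bg_iso A (bg_induced B (f ` {..n})) f"
    using f by (simp add: bg_embedding_def A_sel)
  have inj: "inj_on f {..n}"
    using fi by (simp add: bg_iso_def bij_betw_def A_sel)
  have fE: "(f i, f j) \<in> bedges B \<longleftrightarrow> (i, j) \<in> EA"
    and fP: "(f i, f j) \<in> bpart B \<longleftrightarrow> d i = d j" if "i \<le> n" "j \<le> n" for i j
    using fi that unfolding bg_iso_iff [OF bipA bf] by (auto simp: A_sel bg_induced_def)
  \<comment> \<open>The copy of \<open>F\<close> inside the embedded pattern is carried back to
    \<open>F\<close> by \<open>q\<close>; an automorphism of \<open>B\<close> extending
    \<open>q\<close> then takes \<open>f n\<close> to the required vertex.\<close>
  define q where "q x = g (inv_into {..n} f x)" for x
  have qf: "q (f i) = g i" if "i \<le> n" for i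
    using inj that by (simp add: q_def)
  have sub: "f ` {0..<n} \<subseteq> bverts B" using fV by auto
  have "bg_iso (bg_induced B (f ` {0..<n})) (bg_induced B F) q"
    unfolding bg_iso_iff [OF bipartite_graph_induced [OF bip sub] bipartite_graph_induced [OF bip F(2)]]
  proof (intro conjI ballI)
    have "inj_on f {0..<n}" using inj by (rule inj_on_subset) auto
    moreover have "bij_betw (q \<circ> f) {0..<n} F"
      using g by (subst bij_betw_cong [of _ _ g]) (auto simp: qf)
    ultimately show "bij_betw q (bverts (bg_induced B (f ` {0..<n}))) (bverts (bg_induced B F))"
      using bij_betw_comp_iff [OF inj_on_imp_bij_betw] unfolding bg_induced_def by auto
  next
    fix x y assume "x \<in> bverts (bg_induced B (f ` {0..<n}))" "y \<in> bverts (bg_induced B (f ` {0..<n}))"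
    then obtain i j where ij: "i < n" "x = f i" "j < n" "y = f j" by (auto simp: bg_induced_def)
    show "(q x, q y) \<in> bedges (bg_induced B F) \<longleftrightarrow> (x, y) \<in> bedges (bg_induced B (f ` {0..<n}))"
      using ij gF by (auto simp: bg_induced_def qf fE EA_def)
    show "(q x, q y) \<in> bpart (bg_induced B F) \<longleftrightarrow> (x, y) \<in> bpart (bg_induced B (f ` {0..<n}))"
      using ij gF F(2) fP [of i j] by (auto simp: bg_induced_def qf d_def part)
  qed
  from homog [OF _ sub _ F(2) this] F(1) obtain a where a: "bg_iso B B a" "\<And>i. i < n \<Longrightarrow> a (f i) = g i"
    using qf by auto
  define v where "v = a (f n)"
  have aV: "a x \<in> bverts B" if "x \<in> bverts B" for x
    using a(1) that by (auto simp: bg_iso_def bij_betw_def)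
  have vV: "v \<in> bverts B" using aV fV by (simp add: v_def)
  have E: "(v, g i) \<in> bedges B \<longleftrightarrow> g i \<in> U" if "i < n" for i
  proof -
    have "(v, g i) \<in> bedges B \<longleftrightarrow> (f n, f i) \<in> bedges B"
      using a(1) fV that unfolding bg_iso_iff [OF bip bip] v_def a(2) [OF that, symmetric] by simp
    then show ?thesis using that fE [of n i] by (auto simp: EA_def)
  qed
  have P: "c v = c (g i) \<longleftrightarrow> c (g i) = (\<not> k)" if "i < n" for i
  proof -
    have "(v, g i) \<in> bpart B \<longleftrightarrow> (f n, f i) \<in> bpart B"
      using a(1) fV that unfolding bg_iso_iff [OF bip bip] v_def a(2) [OF that, symmetric] by simp
    then show ?thesis using that fP [of n i] gF [OF that] F(2) vV by (auto simp: part d_def)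
  qed
  have N: "v \<noteq> g i" if "i < n" for i
  proof
    assume "v = g i"
    then have "a (f n) = a (f i)" using a(2) that by (simp add: v_def)
    then have "f n = f i" using a(1) fV that unfolding bg_iso_def bij_betw_def
      by (metis inj_onD le_refl less_imp_le_nat)
    then show False using inj that by (auto dest: inj_onD)
  qed
  have onto: "\<exists>i<n. x = g i" if "x \<in> F" for x using g that by (auto simp: bij_betw_def)
  have "v \<notin> F" using onto N by blast
  moreover have "(v, x) \<in> bedges B \<longleftrightarrow> x \<in> U" if "x \<in> F" for x using onto [OF that] E by auto
  moreover have "c v \<noteq> k" using onto [of w0] P by (auto simp: F_def)
  ultimately show ?thesis using vV by (intro bexI [of _ v]) (auto simp: F_def)
qed

lemma universal_bipartite_graph_imp_universal_bg:
  assumes "universal_bipartite_graph B"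
  shows "\<exists>c. universal_bg B c"
proof -
  have "bipartite_graph B" using assms by (simp add: universal_bipartite_graph_def)
  then obtain c :: "'a \<Rightarrow> bool" where c: "graph (bverts B) (bedges B)"
    "bpart B = {(u, v). u \<in> bverts B \<and> v \<in> bverts B \<and> c u = c v}"
    "\<forall>u v. (u, v) \<in> bedges B \<longrightarrow> c u \<noteq> c v"
    unfolding bipartite_graph_iff_colouring by blast
  have "universal_bg B c"
  proof
    show "countable (bverts B)" using assms by (simp add: universal_bipartite_graph_def)
  qed (use c universal_bipartite_graph_extension [OF assms c(2,3)] in auto)
  then show ?thesis by blast
qed

section \<open>Sparse embeddings and extension of homomorphisms\<close>

text \<open>The case \<open>U = {}\<close> matters: since \<open>k\<close> is then arbitrary, it
  forces both colours to occur in \<open>T\<close>.\<close>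

definition finitely_dominated :: "('a \<times> 'a) set \<Rightarrow> ('a \<Rightarrow> bool) \<Rightarrow> 'a set \<Rightarrow> bool" where
  "finitely_dominated E c T \<longleftrightarrow> (\<forall>U k. finite U \<longrightarrow> U \<subseteq> T \<longrightarrow> (\<forall>u\<in>U. c u = k) \<longrightarrow>
     (\<exists>t\<in>T. c t \<noteq> k \<and> (\<forall>u\<in>U. (t, u) \<in> E)))"

lemma finitely_dominatedD:
  assumes "finitely_dominated E c T" "finite U" "U \<subseteq> T" "\<forall>u\<in>U. c u = k"
  obtains t where "t \<in> T" "c t \<noteq> k" "\<forall>u\<in>U. (t, u) \<in> E"
proof -
  have "\<exists>t\<in>T. c t \<noteq> k \<and> (\<forall>u\<in>U. (t, u) \<in> E)"
    using assms(1) [unfolded finitely_dominated_def, THEN spec, THEN spec, of U k] assms(2-4) by simp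
  then show ?thesis using that by blast
qed

context universal_bg
begin

lemma edge_sym: "(u, v) \<in> bedges B \<Longrightarrow> (v, u) \<in> bedges B"
  using graph by (auto simp: graph_def sym_def)

lemma edge_verts: "(u, v) \<in> bedges B \<Longrightarrow> u \<in> bverts B \<and> v \<in> bverts B"
  using graph by (auto simp: graph_def)

lemma bipartite: "bipartite_graph B"
  unfolding bipartite_graph_iff_colouring using graph part_eq edge_colours by blast

text \<open>At step \<open>n\<close> the image of \<open>n\<close> avoids all adjacencies to the first \<open>n\<close> vertices of \<open>B\<close> outside
  the image, so each vertex outside the image ends up with finitely many neighbours in it.\<close>

lemma sparse_embedding_nat:
  fixes adj :: "nat \<Rightarrow> nat \<Rightarrow> bool" and d :: "nat \<Rightarrow> bool"
  assumes adj: "\<And>m n. adj m n \<Longrightarrow> adj n m" "\<And>m n. adj m n \<Longrightarrow> d m \<noteq> d n"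
  shows "\<exists>\<phi>. inj \<phi> \<and> range \<phi> \<subseteq> bverts B \<and> (\<forall>n. c (\<phi> n) = d n) \<and>
    (\<forall>m n. (\<phi> m, \<phi> n) \<in> bedges B \<longleftrightarrow> adj m n) \<and>
    (\<forall>v\<in>bverts B - range \<phi>. finite {n. (v, \<phi> n) \<in> bedges B})"
proof -
  define iv where "iv = to_nat_on (bverts B)"
  have iv: "inj_on iv (bverts B)" using countable_verts by (simp add: iv_def inj_on_to_nat_on)
  define P where "P \<phi> n r \<longleftrightarrow> r \<in> bverts B \<and> c r = d n \<and>
      (\<forall>m<n. r \<noteq> \<phi> m \<and> ((r, \<phi> m) \<in> bedges B \<longleftrightarrow> adj n m)) \<and>
      (\<forall>b\<in>bverts B. iv b \<le> n \<longrightarrow> b \<notin> \<phi> ` {..<n} \<longrightarrow> (r, b) \<notin> bedges B)" for \<phi> n r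
  have "\<exists>\<phi>. \<forall>n. P \<phi> n (\<phi> n)"
  proof (rule dependent_wf_choice [OF wf_less_than])
    fix f g :: "nat \<Rightarrow> 'v" and n r
    assume fg: "\<And>z. (z, n) \<in> less_than \<Longrightarrow> f z = g z"
    then have "f ` {..<n} = g ` {..<n}" by (auto simp: image_iff)
    then show "P f n r = P g n r" using fg by (simp add: P_def)
  next
    fix n f assume IH: "\<And>m. (m, n) \<in> less_than \<Longrightarrow> P f m (f m)"
    have fV: "f m \<in> bverts B" "c (f m) = d m" if "m < n" for m using IH that by (auto simp: P_def)
    have ne: "f m \<noteq> f l" if "m < n" "l < n" "m \<noteq> l" for m l
      using that IH [of m] IH [of l] unfolding P_def by (metis less_than_iff linorder_neqE_nat)
    \<comment> \<open>The prescribed neighbours form \<open>?U\<close>; among the earlier values and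
      the vertices of index at most \<open>n\<close>, collected in \<open>?W\<close>, all those
      outside \<open>?U\<close> are to be avoided.\<close>
    let ?U = "f ` {m. m < n \<and> adj n m}" and ?W = "f ` {..<n} \<union> {b \<in> bverts B. iv b \<le> n}"
    have "finite (iv ` {b \<in> bverts B. iv b \<le> n})" by (rule finite_subset [of _ "{..n}"]) auto
    then have fin: "finite {b \<in> bverts B. iv b \<le> n}"
      by (rule finite_imageD) (rule inj_on_subset [OF iv], auto)
    have "finite ?U" "finite ?W" "?U \<union> ?W \<subseteq> bverts B" using fin fV by auto
    moreover have "\<forall>u\<in>?U. c u = (\<not> d n)" using fV adj(2) by auto
    ultimately obtain v where v: "v \<in> bverts B - (?U \<union> ?W)" "c v \<noteq> (\<not> d n)"
      "\<forall>u\<in>?U. (v, u) \<in> bedges B" "\<forall>w\<in>?W - ?U. (v, w) \<notin> bedges B"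
      using extension [of ?U ?W "\<not> d n"] by blast
    have "(v, f m) \<in> bedges B \<longleftrightarrow> adj n m" if "m < n" for m
    proof
      assume "(v, f m) \<in> bedges B"
      then have "f m \<in> ?U" using v(4) that by blast
      then show "adj n m" using ne that by auto
    qed (use v(3) that in blast)
    moreover have "(v, b) \<notin> bedges B" if "b \<in> bverts B" "iv b \<le> n" "b \<notin> f ` {..<n}" for b
      using v(4) that by blast
    ultimately have "P f n v" using v(1,2) unfolding P_def by auto
    then show "\<exists>r. P f n r" by blast
  qed
  then obtain \<phi> where \<phi>: "P \<phi> n (\<phi> n)" for n by blast
  have \<phi>V: "\<phi> n \<in> bverts B" "c (\<phi> n) = d n" for n using \<phi> [of n] by (auto simp: P_def)
  have \<phi>_ne: "\<phi> m \<noteq> \<phi> n" if "m < n" for m n using \<phi> [of n] that by (metis P_def)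
  have \<phi>E: "(\<phi> n, \<phi> m) \<in> bedges B \<longleftrightarrow> adj n m" if "m < n" for m n
    using \<phi> [of n] that by (simp add: P_def)
  \<comment> \<open>From stage \<open>iv v\<close> on, every new value avoids adjacency to
    \<open>v\<close>; so only the finitely many earlier values can be neighbours of
    \<open>v\<close>.\<close>
  have \<phi>_sparse: "n < iv v" if "v \<in> bverts B - range \<phi>" "(v, \<phi> n) \<in> bedges B" for v n
  proof -
    have "(\<phi> n, v) \<in> bedges B" using that(2) by (rule edge_sym)
    moreover have "v \<notin> \<phi> ` {..<n}" using that(1) by auto
    ultimately show ?thesis using \<phi> [of n] that(1) unfolding P_def by (meson DiffD1 not_le)
  qed
  have "inj \<phi>" using \<phi>_ne by (rule linorder_injI)
  moreover have "\<forall>m n. (\<phi> m, \<phi> n) \<in> bedges B \<longleftrightarrow> adj m n"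
  proof (intro allI)
    fix m n
    show "(\<phi> m, \<phi> n) \<in> bedges B \<longleftrightarrow> adj m n"
    proof (cases rule: linorder_cases [of m n])
      case less
      then show ?thesis using \<phi>E [OF less] adj(1) edge_sym by blast
    next
      case equal
      then show ?thesis using adj(2) edge_colours by blast
    next
      case greater
      then show ?thesis by (rule \<phi>E)
    qed
  qed
  moreover have "\<forall>v\<in>bverts B - range \<phi>. finite {n. (v, \<phi> n) \<in> bedges B}"
  proof
    fix v assume "v \<in> bverts B - range \<phi>"
    then have "{n. (v, \<phi> n) \<in> bedges B} \<subseteq> {..<iv v}" using \<phi>_sparse by auto
    then show "finite {n. (v, \<phi> n) \<in> bedges B}" by (rule finite_subset) simp
  qed
  ultimately show ?thesis using \<phi>V by (intro exI [of _ \<phi>]) (simp add: image_subset_iff)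
qed

lemma sparse_embedding:
  fixes d :: "'x \<Rightarrow> bool"
  assumes X: "countable X"
    and adj: "\<And>x y. adj x y \<Longrightarrow> adj y x" "\<And>x y. adj x y \<Longrightarrow> d x \<noteq> d y"
  shows "\<exists>\<phi>. inj_on \<phi> X \<and> \<phi> ` X \<subseteq> bverts B \<and> (\<forall>x\<in>X. c (\<phi> x) = d x) \<and>
    (\<forall>x\<in>X. \<forall>y\<in>X. (\<phi> x, \<phi> y) \<in> bedges B \<longleftrightarrow> adj x y) \<and>
    (\<forall>v\<in>bverts B - \<phi> ` X. finite {x \<in> X. (v, \<phi> x) \<in> bedges B})"
proof -
  define I where "I = to_nat_on X ` X"
  define r where "r = from_nat_into X"
  have inj: "inj_on (to_nat_on X) X" using X by (rule inj_on_to_nat_on)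
  have r: "r (to_nat_on X x) = x" if "x \<in> X" for x using that X by (simp add: r_def)
  \<comment> \<open>Indices not coming from \<open>X\<close> are treated as isolated vertices.\<close>
  define adj' where "adj' m n \<longleftrightarrow> m \<in> I \<and> n \<in> I \<and> adj (r m) (r n)" for m n
  obtain \<psi> where \<psi>: "inj \<psi>" "range \<psi> \<subseteq> bverts B" "\<And>n. c (\<psi> n) = d (r n)"
    "\<And>m n. (\<psi> m, \<psi> n) \<in> bedges B \<longleftrightarrow> adj' m n"
    "\<And>v. v \<in> bverts B - range \<psi> \<Longrightarrow> finite {n. (v, \<psi> n) \<in> bedges B}"
  proof -
    have "adj' n m" "d (r m) \<noteq> d (r n)" if "adj' m n" for m n
      using that adj [of "r m" "r n"] by (auto simp: adj'_def)
    from sparse_embedding_nat [of adj' "\<lambda>n. d (r n)", OF this] show ?thesis using that by metis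
  qed
  let ?\<phi> = "\<psi> \<circ> to_nat_on X"
  have "finite {x \<in> X. (v, ?\<phi> x) \<in> bedges B}" if v: "v \<in> bverts B - ?\<phi> ` X" for v
  \<comment> \<open>A vertex outside the image of \<open>X\<close> may still be a value of
    \<open>\<psi>\<close> at an index outside \<open>I\<close>; it then has no neighbour among the
    values of \<open>\<psi>\<close>.\<close>
  proof (cases "v \<in> range \<psi>")
    case True
    then obtain m where m: "v = \<psi> m" by blast
    then have "m \<notin> I" using v by (auto simp: I_def)
    then show ?thesis by (simp add: m \<psi>(4) adj'_def)
  next
    case False
    have "to_nat_on X ` {x \<in> X. (v, ?\<phi> x) \<in> bedges B} \<subseteq> {n. (v, \<psi> n) \<in> bedges B}" by auto
    then have "finite (to_nat_on X ` {x \<in> X. (v, ?\<phi> x) \<in> bedges B})"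
      using \<psi>(5) [of v] False v by (auto intro: finite_subset)
    then show ?thesis by (rule finite_imageD) (rule inj_on_subset [OF inj], auto)
  qed
  moreover have "inj_on ?\<phi> X" using inj \<psi>(1) by (auto intro: comp_inj_on inj_on_subset)
  moreover have "\<forall>x\<in>X. \<forall>y\<in>X. (?\<phi> x, ?\<phi> y) \<in> bedges B \<longleftrightarrow> adj x y"
    using r by (auto simp: \<psi>(4) adj'_def I_def)
  ultimately show ?thesis using \<psi>(2,3) r by (intro exI [of _ ?\<phi>]) auto
qed

text \<open>The remaining vertices are sent into \<open>T\<close> one after another; each of them is subject to
  finitely many adjacency constraints.\<close>

lemma extend_to_endomorphism:
  assumes Y: "Y \<subseteq> bverts B" and TV: "T \<subseteq> bverts B" and T: "finitely_dominated (bedges B) c T" and g: "g ` Y \<subseteq> T"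
    and gc: "\<And>y. y \<in> Y \<Longrightarrow> c (g y) = c y"
    and ge: "\<And>x y. x \<in> Y \<Longrightarrow> y \<in> Y \<Longrightarrow> (x, y) \<in> bedges B \<Longrightarrow> (g x, g y) \<in> bedges B"
    and fin: "\<And>v. v \<in> bverts B - Y \<Longrightarrow> finite {y \<in> Y. (v, y) \<in> bedges B}"
  shows "\<exists>h\<in>carrier (bg_End B). h ` bverts B \<subseteq> T \<and> (\<forall>y\<in>Y. h y = g y)"
proof -
  define iv where "iv = to_nat_on (bverts B)"
  have iv: "inj_on iv (bverts B)" using countable_verts by (simp add: iv_def inj_on_to_nat_on)
  \<comment> \<open>The obligations of \<open>x\<close> mention only \<open>Y\<close> and outside
    vertices of smaller index, which is what well-founded choice along \<open>iv\<close> requires.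
    The value \<open>undefined\<close> off the vertices makes the result extensional, as
    \<open>bg_End\<close> demands.\<close>
  define P where "P h x r \<longleftrightarrow> (if x \<in> Y then r = g x else if x \<in> bverts B then r \<in> T \<and> c r = c x \<and>
      (\<forall>y\<in>Y. (x, y) \<in> bedges B \<longrightarrow> (r, g y) \<in> bedges B) \<and>
      (\<forall>y\<in>bverts B - Y. iv y < iv x \<longrightarrow> (x, y) \<in> bedges B \<longrightarrow> (r, h y) \<in> bedges B)
     else r = undefined)" for h x r
  have "\<exists>h. \<forall>x. P h x (h x)"
  proof (rule dependent_wf_choice [OF wf_measure [of iv]])
    fix f h :: "'v \<Rightarrow> 'v" and x r assume "\<And>z. (z, x) \<in> measure iv \<Longrightarrow> f z = h z"
    then show "P f x r = P h x r" by (auto simp: P_def)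
  next
    fix x h assume IH: "\<And>y. (y, x) \<in> measure iv \<Longrightarrow> P h y (h y)"
    show "\<exists>r. P h x r"
    proof (cases "x \<in> bverts B - Y")
      case False
      then show ?thesis by (auto simp: P_def)
    next
      case True
      let ?U1 = "g ` {y \<in> Y. (x, y) \<in> bedges B}"
      let ?U2 = "h ` {y \<in> bverts B - Y. iv y < iv x \<and> (x, y) \<in> bedges B}"
      have "finite (iv ` {y \<in> bverts B - Y. iv y < iv x \<and> (x, y) \<in> bedges B})"
        by (rule finite_subset [of _ "{..<iv x}"]) auto
      then have "finite {y \<in> bverts B - Y. iv y < iv x \<and> (x, y) \<in> bedges B}"
        by (rule finite_imageD) (rule inj_on_subset [OF iv], auto)
      then have "finite (?U1 \<union> ?U2)" using fin [OF True] by simp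
      moreover have h: "h y \<in> T \<and> c (h y) = c y" if "y \<in> bverts B - Y" "iv y < iv x" for y
        using IH [of y] that by (simp add: P_def)
      have "?U1 \<union> ?U2 \<subseteq> T" using g h by auto
      \<comment> \<open>All neighbours of \<open>x\<close> share the colour opposite to that of
        \<open>x\<close>, and the values chosen so far preserve colours; so the finite constraint
        set is monochromatic and domination applies.\<close>
      moreover have "c y = (\<not> c x)" if "(x, y) \<in> bedges B" for y using edge_colours [OF that] by auto
      then have "\<forall>u\<in>?U1 \<union> ?U2. c u = (\<not> c x)" using gc h by auto
      ultimately obtain t where "t \<in> T" "c t \<noteq> (\<not> c x)" "\<forall>u\<in>?U1 \<union> ?U2. (t, u) \<in> bedges B"
        by (rule finitely_dominatedD [OF T])
      then have "P h x t" using True by (auto simp: P_def)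
      then show ?thesis by blast
    qed
  qed
  then obtain h where h: "P h x (h x)" for x by blast
  have hg: "h y = g y" if "y \<in> Y" for y using h [of y] that by (simp add: P_def)
  have hT: "h x \<in> T \<and> c (h x) = c x" if "x \<in> bverts B" for x
    using h [of x] that hg g gc by (cases "x \<in> Y") (auto simp: P_def)
  have out: "h x = undefined" if "x \<notin> bverts B" for x using h [of x] that Y by (auto simp: P_def split: if_splits)
  have e1: "(h x, h y) \<in> bedges B" if "(x, y) \<in> bedges B" "y \<in> Y" for x y
    using h [of x] that hg ge edge_verts [OF that(1)] by (cases "x \<in> Y") (auto simp: P_def)
  have e2: "(h x, h y) \<in> bedges B" if "(x, y) \<in> bedges B" "x \<notin> Y" "y \<notin> Y" "iv y < iv x" for x y
    using h [of x] that edge_verts [OF that(1)] by (simp add: P_def)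
  have edge: "(h x, h y) \<in> bedges B" if xy: "(x, y) \<in> bedges B" for x y
  proof -
    \<comment> \<open>An edge between two outside vertices is secured when the endpoint of larger
      index is treated; the indices differ because the endpoints have different colours.\<close>
    have "iv x \<noteq> iv y" using iv edge_verts [OF xy] edge_colours [OF xy] by (auto dest: inj_onD)
    then show ?thesis
      using e1 [of x y] e1 [of y x] e2 [of x y] e2 [of y x] xy edge_sym by (meson linorder_neqE_nat)
  qed
  have "h \<in> carrier (bg_End B)"
    using hT TV edge out by (auto simp: bg_End_def bg_hom_def extensional_def part_eq)
  then show ?thesis using hT hg by blast
qed

end

section \<open>Endomorphisms and idempotents\<close>

definition bg_Aut :: "'a bgraph \<Rightarrow> ('a \<Rightarrow> 'a) monoid" where
  "bg_Aut A = \<lparr>carrier = {f \<in> extensional (bverts A). bg_iso A A f},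
     mult = (\<lambda>f g. compose (bverts A) g f), one = (\<lambda>x\<in>bverts A. x)\<rparr>"

context universal_bg
begin

lemma End_iff:
  "f \<in> carrier (bg_End B) \<longleftrightarrow> f \<in> extensional (bverts B) \<and> (\<forall>x\<in>bverts B. f x \<in> bverts B) \<and>
     (\<forall>u v. (u, v) \<in> bedges B \<longrightarrow> (f u, f v) \<in> bedges B) \<and>
     (\<forall>u\<in>bverts B. \<forall>v\<in>bverts B. c u = c v \<longrightarrow> c (f u) = c (f v))"
  unfolding bg_End_def bg_hom_def part_eq Pi_iff by (simp, blast)

lemma EndI:
  assumes "f \<in> extensional (bverts B)" "\<And>x. x \<in> bverts B \<Longrightarrow> f x \<in> bverts B"
    "\<And>u v. (u, v) \<in> bedges B \<Longrightarrow> (f u, f v) \<in> bedges B"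
    "\<And>u v. u \<in> bverts B \<Longrightarrow> v \<in> bverts B \<Longrightarrow> c u = c v \<Longrightarrow> c (f u) = c (f v)"
  shows "f \<in> carrier (bg_End B)"
  unfolding End_iff using assms by blast

lemma End_extensional: "f \<in> carrier (bg_End B) \<Longrightarrow> f \<in> extensional (bverts B)"
  unfolding End_iff by blast

lemma End_closed: "f \<in> carrier (bg_End B) \<Longrightarrow> x \<in> bverts B \<Longrightarrow> f x \<in> bverts B"
  unfolding End_iff by blast

lemma End_edge: "f \<in> carrier (bg_End B) \<Longrightarrow> (u, v) \<in> bedges B \<Longrightarrow> (f u, f v) \<in> bedges B"
  unfolding End_iff by blast

lemma End_part:
  "f \<in> carrier (bg_End B) \<Longrightarrow> u \<in> bverts B \<Longrightarrow> v \<in> bverts B \<Longrightarrow> c u = c v \<Longrightarrow> c (f u) = c (f v)"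
  unfolding End_iff by blast

lemma End_mult: "x \<in> bverts B \<Longrightarrow> (f \<otimes>\<^bsub>bg_End B\<^esub> g) x = g (f x)"
  by (simp add: bg_End_def compose_eq)

lemma End_eqI:
  assumes "f \<in> carrier (bg_End B)" "g \<in> carrier (bg_End B)" "\<And>x. x \<in> bverts B \<Longrightarrow> f x = g x"
  shows "f = g"
  using End_extensional [OF assms(1)] End_extensional [OF assms(2)] assms(3) by (rule extensionalityI)

lemma End_mult_closed:
  assumes f: "f \<in> carrier (bg_End B)" and g: "g \<in> carrier (bg_End B)"
  shows "f \<otimes>\<^bsub>bg_End B\<^esub> g \<in> carrier (bg_End B)"
proof (rule EndI)
  show "f \<otimes>\<^bsub>bg_End B\<^esub> g \<in> extensional (bverts B)" by (simp add: bg_End_def)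
  show "(f \<otimes>\<^bsub>bg_End B\<^esub> g) x \<in> bverts B" if "x \<in> bverts B" for x
    using that by (simp add: End_mult End_closed [OF f] End_closed [OF g])
  show "((f \<otimes>\<^bsub>bg_End B\<^esub> g) u, (f \<otimes>\<^bsub>bg_End B\<^esub> g) v) \<in> bedges B" if "(u, v) \<in> bedges B" for u v
    using End_edge [OF g End_edge [OF f that]] edge_verts [OF that] by (simp add: End_mult)
  show "c ((f \<otimes>\<^bsub>bg_End B\<^esub> g) u) = c ((f \<otimes>\<^bsub>bg_End B\<^esub> g) v)"
    if "u \<in> bverts B" "v \<in> bverts B" "c u = c v" for u v
    using End_part [OF g _ _ End_part [OF f that]] End_closed [OF f] that(1,2) by (simp add: End_mult)
qed

lemma monoid_End: "monoid (bg_End B)"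
proof
  have one: "\<one>\<^bsub>bg_End B\<^esub> x = x" if "x \<in> bverts B" for x using that by (simp add: bg_End_def)
  show one_closed: "\<one>\<^bsub>bg_End B\<^esub> \<in> carrier (bg_End B)"
  proof (rule EndI)
    show "\<one>\<^bsub>bg_End B\<^esub> \<in> extensional (bverts B)" by (simp add: bg_End_def)
  qed (use edge_verts in \<open>simp_all add: one\<close>)
  show "\<one>\<^bsub>bg_End B\<^esub> \<otimes>\<^bsub>bg_End B\<^esub> f = f" if "f \<in> carrier (bg_End B)" for f
    using that by (intro End_eqI End_mult_closed one_closed) (auto simp: End_mult one)
  show "f \<otimes>\<^bsub>bg_End B\<^esub> \<one>\<^bsub>bg_End B\<^esub> = f" if "f \<in> carrier (bg_End B)" for f
    using that by (intro End_eqI End_mult_closed one_closed) (auto simp: End_mult one End_closed)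
  show "f \<otimes>\<^bsub>bg_End B\<^esub> g \<otimes>\<^bsub>bg_End B\<^esub> h = f \<otimes>\<^bsub>bg_End B\<^esub> (g \<otimes>\<^bsub>bg_End B\<^esub> h)"
    if "f \<in> carrier (bg_End B)" "g \<in> carrier (bg_End B)" "h \<in> carrier (bg_End B)" for f g h
    using that by (intro End_eqI End_mult_closed) (auto simp: End_mult End_closed)
qed (rule End_mult_closed)

interpretation End: monoid "bg_End B" by (rule monoid_End)

text \<open>If \<open>u\<close> and \<open>v\<close> had different colours, a neighbour
  \<open>w\<close> of \<open>u\<close> would share the colour of \<open>v\<close>; then
  \<open>f w\<close> has the colour of \<open>f v\<close>, while the edge from \<open>f w\<close> to
  \<open>f u\<close> separates it from that of \<open>f u\<close>. Hence an endomorphism keeps or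
  swaps the colours globally.\<close>

lemma End_colours:
  assumes f: "f \<in> carrier (bg_End B)" and uv: "u \<in> bverts B" "v \<in> bverts B"
  shows "c (f u) = c (f v) \<longleftrightarrow> c u = c v"
proof
  assume eq: "c (f u) = c (f v)"
  show "c u = c v"
  proof (rule ccontr)
    assume ne: "c u \<noteq> c v"
    obtain w where w: "w \<in> bverts B" "(w, u) \<in> bedges B"
      using extension [of "{u}" "{}" "c u"] uv by auto
    then have "c w = c v" using ne edge_colours by blast
    then have "c (f w) = c (f v)" using End_part [OF f w(1) uv(2)] by simp
    then show False using eq edge_colours [OF End_edge [OF f w(2)]] by simp
  qed
qed (use End_part [OF assms] in simp)

section \<open>Idempotent endomorphisms and their images\<close>

lemma idempotent_iff:
  "e \<in> idempotents (bg_End B) \<longleftrightarrow> e \<in> carrier (bg_End B) \<and> (\<forall>x\<in>bverts B. e (e x) = e x)"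
proof -
  have "e \<otimes>\<^bsub>bg_End B\<^esub> e = e \<longleftrightarrow> (\<forall>x\<in>bverts B. e (e x) = e x)" if "e \<in> carrier (bg_End B)"
    using that End_eqI [OF End_mult_closed [OF that that] that] End_mult [of _ e e] by metis
  then show ?thesis by (auto simp: idempotents_def)
qed

text \<open>Idempotents cannot swap the parts: \<open>e x\<close> and \<open>x\<close> have the same
  value under \<open>e\<close>, and endomorphisms reflect equality of colours.\<close>

lemma idempotent_colour:
  assumes e: "e \<in> idempotents (bg_End B)" and x: "x \<in> bverts B"
  shows "c (e x) = c x"
  using End_colours [of e "e x" x] e x by (simp add: idempotent_iff End_closed)

lemma idempotent_image_subset: "e \<in> idempotents (bg_End B) \<Longrightarrow> e ` bverts B \<subseteq> bverts B"
  by (auto simp: idempotent_iff End_closed)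

text \<open>An edge between two vertices of the image is fixed by \<open>e\<close>, hence is the
  image of itself; passing to the induced graph therefore adds no edges.\<close>

lemma idempotent_image:
  assumes e: "e \<in> idempotents (bg_End B)"
  shows "bg_image B e = bg_induced B (e ` bverts B)"
proof -
  have "map_prod e e ` bedges B = bedges B \<inter> (e ` bverts B) \<times> (e ` bverts B)"
  proof (intro equalityI subsetI)
    fix p assume "p \<in> map_prod e e ` bedges B"
    then show "p \<in> bedges B \<inter> (e ` bverts B) \<times> (e ` bverts B)"
      using e End_edge edge_verts by (fastforce simp: idempotent_iff)
  next
    fix p assume p: "p \<in> bedges B \<inter> (e ` bverts B) \<times> (e ` bverts B)"
    then have "map_prod e e p = p" using e by (auto simp: idempotent_iff)
    then show "p \<in> map_prod e e ` bedges B" using p by (metis IntD1 image_eqI)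
  qed
  then show ?thesis by (simp add: bg_image_def bg_induced_def)
qed

lemma bipartite_idempotent_image:
  "e \<in> idempotents (bg_End B) \<Longrightarrow> bipartite_graph (bg_image B e)"
  using bipartite_graph_induced [OF bipartite] idempotent_image_subset idempotent_image by simp

lemma idempotent_image_sel:
  assumes "e \<in> idempotents (bg_End B)"
  shows "bverts (bg_image B e) = e ` bverts B"
    "bedges (bg_image B e) = bedges B \<inter> (e ` bverts B) \<times> (e ` bverts B)"
    "bpart (bg_image B e) = {(u, v). u \<in> e ` bverts B \<and> v \<in> e ` bverts B \<and> c u = c v}"
  using idempotent_image_subset [OF assms] unfolding idempotent_image [OF assms] bg_induced_def part_eq
  by auto

text \<open>A common neighbour of \<open>U\<close> exists in \<open>B\<close>, and \<open>e\<close>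
  moves it into the image while fixing \<open>U\<close> pointwise.\<close>

lemma finitely_dominated_idempotent_image:
  assumes e: "e \<in> idempotents (bg_End B)"
  shows "finitely_dominated (bedges B) c (e ` bverts B)"
  unfolding finitely_dominated_def
proof (intro allI impI)
  fix U k assume U: "finite U" "U \<subseteq> e ` bverts B" "\<forall>u\<in>U. c u = k"
  have "U \<union> {} \<subseteq> bverts B" using U(2) idempotent_image_subset [OF e] by blast
  from extension [OF U(1) finite.emptyI this U(3)]
  obtain v where v: "v \<in> bverts B" "c v \<noteq> k" "\<forall>u\<in>U. (v, u) \<in> bedges B" by blast
  have "(e v, u) \<in> bedges B" if "u \<in> U" for u
  proof -
    have "(e v, e u) \<in> bedges B" using e v(3) that by (auto simp: idempotent_iff intro: End_edge)
    moreover have "e u = u" using e U(2) that by (auto simp: idempotent_iff)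
    ultimately show ?thesis by simp
  qed
  then show "\<exists>t\<in>e ` bverts B. c t \<noteq> k \<and> (\<forall>u\<in>U. (t, u) \<in> bedges B)"
    using v idempotent_colour [OF e v(1)] by (intro bexI [of _ "e v"]) auto
qed

lemma iso_idempotent_image_iff:
  assumes A: "bipartite_graph A" and e: "e \<in> idempotents (bg_End B)"
  shows "bg_iso A (bg_image B e) \<psi> \<longleftrightarrow> bij_betw \<psi> (bverts A) (e ` bverts B) \<and>
    (\<forall>u\<in>bverts A. \<forall>v\<in>bverts A. ((\<psi> u, \<psi> v) \<in> bedges B \<longleftrightarrow> (u, v) \<in> bedges A) \<and>
       (c (\<psi> u) = c (\<psi> v) \<longleftrightarrow> (u, v) \<in> bpart A))"
  unfolding bg_iso_iff [OF A bipartite_idempotent_image [OF e]] idempotent_image_sel [OF e]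
proof (intro conj_cong refl)
  assume "bij_betw \<psi> (bverts A) (e ` bverts B)"
  then have "\<psi> u \<in> e ` bverts B" if "u \<in> bverts A" for u using that by (auto simp: bij_betw_def)
  then show "(\<forall>u\<in>bverts A. \<forall>v\<in>bverts A.
       ((\<psi> u, \<psi> v) \<in> bedges B \<inter> e ` bverts B \<times> e ` bverts B \<longleftrightarrow> (u, v) \<in> bedges A) \<and>
       ((\<psi> u, \<psi> v) \<in> {(u, v). u \<in> e ` bverts B \<and> v \<in> e ` bverts B \<and> c u = c v} \<longleftrightarrow> (u, v) \<in> bpart A)) =
     (\<forall>u\<in>bverts A. \<forall>v\<in>bverts A. ((\<psi> u, \<psi> v) \<in> bedges B \<longleftrightarrow> (u, v) \<in> bedges A) \<and>
       (c (\<psi> u) = c (\<psi> v) \<longleftrightarrow> (u, v) \<in> bpart A))"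
    by (intro ball_cong refl) simp
qed

text \<open>If \<open>e\<close> and \<open>f\<close> are the two products of \<open>x\<close> and
  \<open>y\<close>, then \<open>x\<close> and \<open>y\<close> restrict to mutually inverse
  isomorphisms of the images. Conversely, an isomorphism \<open>\<theta>\<close> of the images
  extends to \<open>B\<close> by retracting first: \<open>x\<close> is \<open>e\<close> followed by
  \<open>\<theta>\<close>, and \<open>y\<close> is \<open>f\<close> followed by the inverse of
  \<open>\<theta>\<close>.\<close>

lemma green_D_idempotents_iff_isomorphic:
  assumes e: "e \<in> idempotents (bg_End B)" and f: "f \<in> idempotents (bg_End B)"
  shows "(e, f) \<in> green_D (bg_End B) \<longleftrightarrow> bg_isomorphic (bg_image B e) (bg_image B f)"
proof
  assume "(e, f) \<in> green_D (bg_End B)"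
  then obtain x y where xy: "x \<in> carrier (bg_End B)" "y \<in> carrier (bg_End B)"
    "x \<otimes>\<^bsub>bg_End B\<^esub> y = e" "y \<otimes>\<^bsub>bg_End B\<^esub> x = f"
    unfolding End.green_D_idempotents_iff [OF e f] by blast
  have yx: "y (x v) = e v" "x (y v) = f v" if "v \<in> bverts B" for v
    using that xy(3,4) End_mult by metis+
  have eV: "e v \<in> bverts B" "e (e v) = e v" "f v \<in> bverts B" "f (f v) = f v" if "v \<in> bverts B" for v
    using e f that by (auto simp: idempotent_iff End_closed)
  have et: "t \<in> bverts B \<and> y (x t) = t \<and> f (x t) = x t" if "t \<in> e ` bverts B" for t
  proof -
    have t: "t \<in> bverts B" "e t = t" using that eV by auto
    then show ?thesis using yx(1) [of t] yx(2) [of "x t"] End_closed [OF xy(1)] by simp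
  qed
  have ft: "t \<in> bverts B \<and> x (y t) = t \<and> e (y t) = y t" if "t \<in> f ` bverts B" for t
  proof -
    have t: "t \<in> bverts B" "f t = t" using that eV by auto
    then show ?thesis using yx(2) [of t] yx(1) [of "y t"] End_closed [OF xy(2)] by simp
  qed
  have "bg_iso (bg_image B e) (bg_image B f) x"
    unfolding iso_idempotent_image_iff [OF bipartite_idempotent_image [OF e] f] idempotent_image_sel [OF e]
  proof (intro conjI ballI)
    have "x t \<in> f ` bverts B" if "t \<in> e ` bverts B" for t
      using et [OF that] End_closed [OF xy(1)] by (metis image_eqI)
    moreover have "y t \<in> e ` bverts B" if "t \<in> f ` bverts B" for t
      using ft [OF that] End_closed [OF xy(2)] by (metis image_eqI)
    ultimately show "bij_betw x (e ` bverts B) (f ` bverts B)"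
      using et ft by (intro bij_betw_byWitness [of _ y] ballI image_subsetI) blast+
  next
    fix t t' assume t: "t \<in> e ` bverts B" "t' \<in> e ` bverts B"
    show "(x t, x t') \<in> bedges B \<longleftrightarrow> (t, t') \<in> bedges B \<inter> e ` bverts B \<times> e ` bverts B"
      using t et [OF t(1)] et [OF t(2)] End_edge [OF xy(1), of t t'] End_edge [OF xy(2), of "x t" "x t'"]
      by auto
    show "c (x t) = c (x t') \<longleftrightarrow> (t, t') \<in> {(u, v). u \<in> e ` bverts B \<and> v \<in> e ` bverts B \<and> c u = c v}"
      using t et [OF t(1)] et [OF t(2)] End_colours [OF xy(1)] by auto
  qed
  then show "bg_isomorphic (bg_image B e) (bg_image B f)" by (auto simp: bg_isomorphic_def)
next
  assume "bg_isomorphic (bg_image B e) (bg_image B f)"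
  then obtain \<theta> where "bg_iso (bg_image B e) (bg_image B f) \<theta>" by (auto simp: bg_isomorphic_def)
  then have bij: "bij_betw \<theta> (e ` bverts B) (f ` bverts B)"
    and E: "\<And>t t'. t \<in> e ` bverts B \<Longrightarrow> t' \<in> e ` bverts B \<Longrightarrow> (\<theta> t, \<theta> t') \<in> bedges B \<longleftrightarrow> (t, t') \<in> bedges B"
    and P: "\<And>t t'. t \<in> e ` bverts B \<Longrightarrow> t' \<in> e ` bverts B \<Longrightarrow> c (\<theta> t) = c (\<theta> t') \<longleftrightarrow> c t = c t'"
    unfolding iso_idempotent_image_iff [OF bipartite_idempotent_image [OF e] f] idempotent_image_sel [OF e]
    by auto
  define \<eta> where "\<eta> = inv_into (e ` bverts B) \<theta>"
  have \<theta>: "\<theta> t \<in> f ` bverts B" "\<eta> (\<theta> t) = t" if "t \<in> e ` bverts B" for t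
    using bij that by (auto simp: \<eta>_def bij_betw_def)
  have \<eta>: "\<eta> t \<in> e ` bverts B" "\<theta> (\<eta> t) = t" if "t \<in> f ` bverts B" for t
    using bij that by (auto simp: \<eta>_def bij_betw_inv_into_right bij_betw_def intro: inv_into_into)
  have eV: "e v \<in> bverts B" "e (e v) = e v" "f v \<in> bverts B" "f (f v) = f v" if "v \<in> bverts B" for v
    using e f that by (auto simp: idempotent_iff End_closed)
  have fixed: "t \<in> e ` bverts B \<Longrightarrow> t \<in> bverts B \<and> e t = t" "t \<in> f ` bverts B \<Longrightarrow> t \<in> bverts B \<and> f t = t" for t
    using eV by auto
  have ef: "(u, v) \<in> bedges B \<Longrightarrow> (e u, e v) \<in> bedges B" "(u, v) \<in> bedges B \<Longrightarrow> (f u, f v) \<in> bedges B" for u v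
    using e f End_edge by (auto simp: idempotent_iff)
  have E': "(\<eta> t, \<eta> t') \<in> bedges B \<longleftrightarrow> (t, t') \<in> bedges B" and P': "c (\<eta> t) = c (\<eta> t') \<longleftrightarrow> c t = c t'"
    if "t \<in> f ` bverts B" "t' \<in> f ` bverts B" for t t'
    using E [of "\<eta> t" "\<eta> t'"] P [of "\<eta> t" "\<eta> t'"] \<eta> that by auto
  define x where "x = (\<lambda>v\<in>bverts B. \<theta> (e v))"
  define y where "y = (\<lambda>v\<in>bverts B. \<eta> (f v))"
  have x: "x \<in> carrier (bg_End B)"
  proof (rule EndI)
    fix u v assume uv: "(u, v) \<in> bedges B"
    then have "u \<in> bverts B" "v \<in> bverts B" using edge_verts by auto
    then show "(x u, x v) \<in> bedges B" using E [of "e u" "e v"] ef [OF uv] by (simp add: x_def)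
  next
    fix u v assume "u \<in> bverts B" "v \<in> bverts B" "c u = c v"
    then show "c (x u) = c (x v)"
      using P [of "e u" "e v"] idempotent_colour [OF e] by (simp add: x_def)
  next
    fix v assume v: "v \<in> bverts B"
    then have "\<theta> (e v) \<in> bverts B" using \<theta>(1) [of "e v"] fixed(2) by blast
    then show "x v \<in> bverts B" using v by (simp add: x_def)
  qed (simp add: x_def)
  have y: "y \<in> carrier (bg_End B)"
  proof (rule EndI)
    fix u v assume uv: "(u, v) \<in> bedges B"
    then have "u \<in> bverts B" "v \<in> bverts B" using edge_verts by auto
    then show "(y u, y v) \<in> bedges B" using E' [of "f u" "f v"] ef [OF uv] by (simp add: y_def)
  next
    fix u v assume "u \<in> bverts B" "v \<in> bverts B" "c u = c v"
    then show "c (y u) = c (y v)"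
      using P' [of "f u" "f v"] idempotent_colour [OF f] by (simp add: y_def)
  next
    fix v assume v: "v \<in> bverts B"
    then have "\<eta> (f v) \<in> bverts B" using \<eta>(1) [of "f v"] fixed(1) by blast
    then show "y v \<in> bverts B" using v by (simp add: y_def)
  qed (simp add: y_def)
  have "x \<otimes>\<^bsub>bg_End B\<^esub> y = e"
  proof (rule End_eqI)
    fix v assume v: "v \<in> bverts B"
    then have "\<theta> (e v) \<in> f ` bverts B" using \<theta> by simp
    then show "(x \<otimes>\<^bsub>bg_End B\<^esub> y) v = e v"
      using v fixed(2) [of "\<theta> (e v)"] \<theta>(2) [of "e v"] by (simp add: End_mult x_def y_def)
  qed (use x y e in \<open>auto simp: idempotents_def\<close>)
  moreover have "y \<otimes>\<^bsub>bg_End B\<^esub> x = f"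
  proof (rule End_eqI)
    fix v assume v: "v \<in> bverts B"
    then have "\<eta> (f v) \<in> e ` bverts B" using \<eta> by simp
    then show "(y \<otimes>\<^bsub>bg_End B\<^esub> x) v = f v"
      using v fixed(1) [of "\<eta> (f v)"] \<eta>(2) [of "f v"] by (simp add: End_mult x_def y_def)
  qed (use x y f in \<open>auto simp: idempotents_def\<close>)
  ultimately show "(e, f) \<in> green_D (bg_End B)"
    using x y unfolding End.green_D_idempotents_iff [OF e f] by blast
qed

text \<open>The class consists of the units of the local monoid at \<open>e\<close>. Such an
  \<open>h\<close> satisfies \<open>h (e v) = h v\<close>, so it is determined by its restriction to
  the image, where it is an automorphism; \<open>F\<close> transports this restriction to
  \<open>A\<close>. Allowing any copy \<open>A\<close> of the image lets \<open>block_graph\<close>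
  and \<open>K11\<close> be used directly.\<close>

lemma H_class_group_iso_Aut:
  assumes e: "e \<in> idempotents (bg_End B)" and A: "bipartite_graph A"
    and \<psi>: "bg_iso A (bg_image B e) \<psi>"
  shows "H_class_group (bg_End B) (green_H (bg_End B) `` {e}) \<cong> bg_Aut A"
proof -
  let ?T = "e ` bverts B"
  let ?H = "green_H (bg_End B) `` {e}"
  have bij: "bij_betw \<psi> (bverts A) ?T"
    and E: "\<And>u v. u \<in> bverts A \<Longrightarrow> v \<in> bverts A \<Longrightarrow> (\<psi> u, \<psi> v) \<in> bedges B \<longleftrightarrow> (u, v) \<in> bedges A"
    and P: "\<And>u v. u \<in> bverts A \<Longrightarrow> v \<in> bverts A \<Longrightarrow> c (\<psi> u) = c (\<psi> v) \<longleftrightarrow> (u, v) \<in> bpart A"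
    using \<psi> unfolding iso_idempotent_image_iff [OF A e] by auto
  define \<eta> where "\<eta> = inv_into (bverts A) \<psi>"
  have \<psi>T: "\<psi> t \<in> ?T" "\<eta> (\<psi> t) = t" if "t \<in> bverts A" for t
    using bij that by (auto simp: \<eta>_def bij_betw_def)
  have \<eta>: "\<eta> t \<in> bverts A" "\<psi> (\<eta> t) = t" if "t \<in> ?T" for t
    using bij that by (auto simp: \<eta>_def bij_betw_inv_into_right bij_betw_def intro: inv_into_into)
  have ec: "e \<in> carrier (bg_End B)" using e by (simp add: idempotent_iff)
  have T: "t \<in> bverts B" "e t = t" if "t \<in> ?T" for t using e that by (auto simp: idempotent_iff End_closed)
  have H_D: "h \<in> carrier (bg_End B) \<and> (\<forall>v\<in>bverts B. h (e v) = h v \<and> h v \<in> ?T) \<and>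
      (\<exists>k\<in>carrier (bg_End B). \<forall>t\<in>?T. k t \<in> ?T \<and> k (h t) = t \<and> h (k t) = t)" if h: "h \<in> ?H" for h
  proof -
    obtain k where k: "h \<in> carrier (bg_End B)" "k \<in> carrier (bg_End B)"
      "e \<otimes>\<^bsub>bg_End B\<^esub> h = h" "h \<otimes>\<^bsub>bg_End B\<^esub> e = h" "k \<otimes>\<^bsub>bg_End B\<^esub> e = k"
      "h \<otimes>\<^bsub>bg_End B\<^esub> k = e" "k \<otimes>\<^bsub>bg_End B\<^esub> h = e"
      using h unfolding Image_singleton_iff End.green_H_idempotent_iff [OF e] by blast
    have p: "h (e v) = h v" "e (h v) = h v" "e (k v) = k v" "k (h v) = e v" "h (k v) = e v"
      if "v \<in> bverts B" for v using that k(3-7) End_mult by metis+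
    have hk: "h v \<in> ?T" "k v \<in> ?T" if "v \<in> bverts B" for v
      using p(2,3) [OF that] End_closed [OF k(1) that] End_closed [OF k(2) that] by (metis image_eqI)+
    have "k t \<in> ?T \<and> k (h t) = t \<and> h (k t) = t" if "t \<in> ?T" for t
      unfolding p(4,5) [OF T(1) [OF that]] T(2) [OF that] using hk(2) [OF T(1) [OF that]] by simp
    then show ?thesis using k(1,2) p(1) hk(1) by blast
  qed
  define F where "F h = (\<lambda>x\<in>bverts A. \<eta> (h (\<psi> x)))" for h
  have F_Aut: "F h \<in> carrier (bg_Aut A)" if h: "h \<in> ?H" for h
  proof -
    obtain k where k: "k \<in> carrier (bg_End B)" "\<And>t. t \<in> ?T \<Longrightarrow> k t \<in> ?T \<and> k (h t) = t \<and> h (k t) = t"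
      using H_D [OF h] by blast
    have hc: "h \<in> carrier (bg_End B)" and hT: "\<And>t. t \<in> ?T \<Longrightarrow> h t \<in> ?T"
      using H_D [OF h] T(1) by blast+
    have Eh: "(h t, h t') \<in> bedges B \<longleftrightarrow> (t, t') \<in> bedges B" if "t \<in> ?T" "t' \<in> ?T" for t t'
      using End_edge [OF hc, of t t'] End_edge [OF k(1), of "h t" "h t'"] k(2) [OF that(1)] k(2) [OF that(2)] by auto
    have "bij_betw (F h) (bverts A) (bverts A)"
      by (intro bij_betw_byWitness [of _ "\<lambda>x. \<eta> (k (\<psi> x))"] ballI image_subsetI)
        (simp_all add: F_def \<psi>T \<eta> hT k(2))
    moreover have "(F h u, F h v) \<in> bedges A \<longleftrightarrow> (u, v) \<in> bedges A"
      "(F h u, F h v) \<in> bpart A \<longleftrightarrow> (u, v) \<in> bpart A" if "u \<in> bverts A" "v \<in> bverts A" for u v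
      unfolding E [OF that, symmetric] P [OF that, symmetric]
      using that \<psi>T(1) [OF that(1)] \<psi>T(1) [OF that(2)]
      by (simp_all add: F_def E [symmetric] P [symmetric] \<eta> hT Eh End_colours [OF hc] T(1))
    ultimately show ?thesis unfolding bg_Aut_def bg_iso_iff [OF A A] by (auto simp: F_def)
  qed
  have "F \<in> hom (H_class_group (bg_End B) ?H) (bg_Aut A)"
    unfolding hom_def
  proof (intro CollectI conjI ballI)
    show "F \<in> carrier (H_class_group (bg_End B) ?H) \<rightarrow> carrier (bg_Aut A)"
      using F_Aut by (auto simp: H_class_group_def)
    fix h k assume "h \<in> carrier (H_class_group (bg_End B) ?H)" "k \<in> carrier (H_class_group (bg_End B) ?H)"
    then have "h \<in> ?H" "k \<in> ?H" by (auto simp: H_class_group_def)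
    then have "h t \<in> ?T" if "t \<in> ?T" for t using H_D that T by blast
    then show "F (h \<otimes>\<^bsub>H_class_group (bg_End B) ?H\<^esub> k) = F h \<otimes>\<^bsub>bg_Aut A\<^esub> F k"
      unfolding F_def by (intro ext)
        (simp add: H_class_group_def bg_Aut_def End_mult compose_def \<psi>T(1) \<eta> T(1))
  qed
  moreover have "inj_on F ?H"
  proof (rule inj_onI)
    fix h k assume hk: "h \<in> ?H" "k \<in> ?H" "F h = F k"
    have "h t = k t" if "t \<in> ?T" for t
    proof -
      have "\<eta> (h t) = \<eta> (k t)" using fun_cong [OF hk(3), of "\<eta> t"] \<eta> that by (simp add: F_def)
      then show ?thesis using \<eta>(2) [of "h t"] \<eta>(2) [of "k t"] H_D hk(1,2) T(1) [OF that] by metis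
    qed
    moreover have "h v = h (e v)" "k v = k (e v)" if "v \<in> bverts B" for v
      using H_D [OF hk(1)] H_D [OF hk(2)] that by simp_all
    moreover have "h \<in> carrier (bg_End B)" "k \<in> carrier (bg_End B)"
      using H_D [OF hk(1)] H_D [OF hk(2)] by blast+
    ultimately show "h = k" by (metis End_eqI image_eqI)
  qed
  moreover have "carrier (bg_Aut A) \<subseteq> F ` ?H"
  proof
    fix \<alpha> assume "\<alpha> \<in> carrier (bg_Aut A)"
    then have \<alpha>: "\<alpha> \<in> extensional (bverts A)" "bij_betw \<alpha> (bverts A) (bverts A)"
      and \<alpha>E: "\<And>u v. u \<in> bverts A \<Longrightarrow> v \<in> bverts A \<Longrightarrow> (\<alpha> u, \<alpha> v) \<in> bedges A \<longleftrightarrow> (u, v) \<in> bedges A"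
      and \<alpha>P: "\<And>u v. u \<in> bverts A \<Longrightarrow> v \<in> bverts A \<Longrightarrow> (\<alpha> u, \<alpha> v) \<in> bpart A \<longleftrightarrow> (u, v) \<in> bpart A"
      unfolding bg_Aut_def by (auto simp: bg_iso_iff [OF A A])
    define \<beta> where "\<beta> = inv_into (bverts A) \<alpha>"
    have \<alpha>V: "\<alpha> t \<in> bverts A" "\<beta> (\<alpha> t) = t" "\<beta> t \<in> bverts A" "\<alpha> (\<beta> t) = t" if "t \<in> bverts A" for t
      using \<alpha>(2) that by (auto simp: \<beta>_def bij_betw_inv_into_right bij_betw_def intro: inv_into_into)
    have \<beta>E: "(\<beta> u, \<beta> v) \<in> bedges A \<longleftrightarrow> (u, v) \<in> bedges A" "(\<beta> u, \<beta> v) \<in> bpart A \<longleftrightarrow> (u, v) \<in> bpart A"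
      if "u \<in> bverts A" "v \<in> bverts A" for u v
      using \<alpha>E [of "\<beta> u" "\<beta> v"] \<alpha>P [of "\<beta> u" "\<beta> v"] \<alpha>V that by auto
    \<comment> \<open>The map \<open>\<gamma>\<close> on \<open>A\<close> becomes a map on
      \<open>B\<close>: retract to the image by \<open>e\<close>, then apply \<open>\<gamma>\<close>
      in the coordinates given by \<open>\<psi>\<close>.\<close>
    define lift where "lift \<gamma> = (\<lambda>v\<in>bverts B. \<psi> (\<gamma> (\<eta> (e v))))" for \<gamma>
    have lift: "lift \<gamma> \<in> carrier (bg_End B)"
      if "\<And>u. u \<in> bverts A \<Longrightarrow> \<gamma> u \<in> bverts A"
        "\<And>u v. u \<in> bverts A \<Longrightarrow> v \<in> bverts A \<Longrightarrow> (\<gamma> u, \<gamma> v) \<in> bedges A \<longleftrightarrow> (u, v) \<in> bedges A"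
        "\<And>u v. u \<in> bverts A \<Longrightarrow> v \<in> bverts A \<Longrightarrow> (\<gamma> u, \<gamma> v) \<in> bpart A \<longleftrightarrow> (u, v) \<in> bpart A" for \<gamma>
    proof (rule EndI)
      fix u v assume uv: "(u, v) \<in> bedges B"
      then have V: "u \<in> bverts B" "v \<in> bverts B" using edge_verts by auto
      have "(\<psi> (\<eta> (e u)), \<psi> (\<eta> (e v))) \<in> bedges B" using \<eta>(2) V End_edge [OF ec uv] by simp
      then have "(\<eta> (e u), \<eta> (e v)) \<in> bedges A" using E \<eta>(1) V by simp
      then show "(lift \<gamma> u, lift \<gamma> v) \<in> bedges B" using E \<eta>(1) V that(1,2) by (simp add: lift_def)
    next
      fix u v assume V: "u \<in> bverts B" "v \<in> bverts B" and uv: "c u = c v"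
      have "c (\<psi> (\<eta> (e u))) = c (\<psi> (\<eta> (e v)))" using \<eta>(2) V idempotent_colour [OF e] uv by simp
      then have "(\<eta> (e u), \<eta> (e v)) \<in> bpart A" using P \<eta>(1) V by simp
      then show "c (lift \<gamma> u) = c (lift \<gamma> v)" using P \<eta>(1) V that(1,3) by (simp add: lift_def)
    qed (use T(1) \<psi>T \<eta> that in \<open>auto simp: lift_def\<close>)
    let ?h = "lift \<alpha>" and ?k = "lift \<beta>"
    have h: "?h \<in> carrier (bg_End B)" using \<alpha>V \<alpha>E \<alpha>P by (intro lift) auto
    have k: "?k \<in> carrier (bg_End B)" using \<alpha>V \<beta>E by (intro lift) auto
    have lT: "e v \<in> ?T" "\<eta> (e v) \<in> bverts A" "\<psi> (\<alpha> (\<eta> (e v))) \<in> ?T" "\<psi> (\<beta> (\<eta> (e v))) \<in> ?T"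
      if "v \<in> bverts B" for v using that \<psi>T \<eta> \<alpha>V by auto
    have "(e, ?h) \<in> green_H (bg_End B)" unfolding End.green_H_idempotent_iff [OF e]
    proof (intro conjI bexI [of _ ?k] h k)
      have ee: "e v \<in> bverts B" "e (e v) = e v" if "v \<in> bverts B" for v
        using that e by (auto simp: idempotent_iff End_closed)
      have el: "e (?h v) = ?h v" "e (?k v) = ?k v" "?h v \<in> bverts B" "?k v \<in> bverts B"
        if "v \<in> bverts B" for v
        using T [OF lT(3) [OF that]] T [OF lT(4) [OF that]] that by (simp_all add: lift_def)
      have "?h (e v) = ?h v" "?k (e v) = ?k v" if "v \<in> bverts B" for v
        using that ee [OF that] by (simp_all add: lift_def)
      moreover have "?k (?h v) = e v" "?h (?k v) = e v" if "v \<in> bverts B" for v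
      proof -
        have "?k (?h v) = \<psi> (\<beta> (\<eta> (?h v)))" "?h (?k v) = \<psi> (\<alpha> (\<eta> (?k v)))"
          using el [OF that] by (simp_all add: lift_def [of \<alpha>] lift_def [of \<beta>])
        then show "?k (?h v) = e v" "?h (?k v) = e v"
          using that lT [OF that] by (simp_all add: lift_def \<psi>T(2) \<alpha>V \<eta>(2))
      qed
      ultimately show "e \<otimes>\<^bsub>bg_End B\<^esub> ?h = ?h" "?h \<otimes>\<^bsub>bg_End B\<^esub> e = ?h" "e \<otimes>\<^bsub>bg_End B\<^esub> ?k = ?k"
        "?k \<otimes>\<^bsub>bg_End B\<^esub> e = ?k" "?h \<otimes>\<^bsub>bg_End B\<^esub> ?k = e" "?k \<otimes>\<^bsub>bg_End B\<^esub> ?h = e"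
        using el by (auto intro!: End_eqI End_mult_closed h k ec simp: End_mult)
    qed
    moreover have "F ?h = \<alpha>"
    proof (rule extensionalityI)
      fix x assume x: "x \<in> bverts A"
      then show "F ?h x = \<alpha> x" using T [OF \<psi>T(1) [OF x]] by (simp add: F_def lift_def \<psi>T(2) \<alpha>V)
    qed (use \<alpha>(1) in \<open>simp_all add: F_def\<close>)
    ultimately show "\<alpha> \<in> F ` ?H" by (intro image_eqI [of _ _ ?h]) simp_all
  qed
  ultimately have "F \<in> iso (H_class_group (bg_End B) ?H) (bg_Aut A)"
    using F_Aut by (auto simp: iso_def bij_betw_def H_class_group_def)
  then show ?thesis by (auto simp: is_iso_def)
qed

end

section \<open>Images and the graph K11\<close>

lemma finitely_dominated_restrict:
  assumes "finitely_dominated E c T"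
  shows "finitely_dominated (E \<inter> T \<times> T) c T"
  unfolding finitely_dominated_def
proof (intro allI impI)
  fix U k assume U: "finite U" "U \<subseteq> T" "\<forall>u\<in>U. c u = k"
  obtain t where t: "t \<in> T" "c t \<noteq> k" "\<forall>u\<in>U. (t, u) \<in> E" by (rule finitely_dominatedD [OF assms U])
  then show "\<exists>t\<in>T. c t \<noteq> k \<and> (\<forall>u\<in>U. (t, u) \<in> E \<inter> T \<times> T)" using U(2) by blast
qed

lemma bipartite_graph_K11: "bipartite_graph K11"
  unfolding bipartite_graph_iff_colouring
  by (intro conjI exI [of _ "\<lambda>b. b"]) (auto simp: K11_def graph_def irrefl_def sym_def)

lemma K11_sel:
  "bverts K11 = UNIV" "(a, b) \<in> bedges K11 \<longleftrightarrow> a \<noteq> b" "(a, b) \<in> bpart K11 \<longleftrightarrow> a = b"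
  by (auto simp: K11_def)

lemma bg_Aut_K11: "bg_Aut K11 \<cong> integer_mod_group 2"
proof -
  have carr: "carrier (bg_Aut K11) = {id, Not}"
  proof (intro equalityI subsetI)
    fix f assume "f \<in> carrier (bg_Aut K11)"
    then have "inj f" by (auto simp: bg_Aut_def bg_iso_def bij_betw_def K11_def)
    then have "f True \<noteq> f False" by (auto dest: injD)
    then have "f = id \<or> f = Not" by (cases "f True") (auto simp: fun_eq_iff all_bool_eq)
    then show "f \<in> {id, Not}" by simp
  next
    fix f assume f: "f \<in> {id, Not :: bool \<Rightarrow> bool}"
    then have "bij f" by (auto intro: involuntory_imp_bij)
    then show "f \<in> carrier (bg_Aut K11)"
      using f unfolding bg_Aut_def by (auto simp: bg_iso_iff [OF bipartite_graph_K11 bipartite_graph_K11]) (auto simp: K11_def)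
  qed
  let ?F = "\<lambda>f. if f False then 1 else 0 :: int"
  have "?F \<in> iso (bg_Aut K11) (integer_mod_group 2)"
    unfolding iso_def hom_def carr
    by (auto simp: bij_betw_def inj_on_def bg_Aut_def K11_def compose_def integer_mod_group_def image_iff
        carrier_integer_mod_group fun_eq_iff)
  then show ?thesis by (auto simp: is_iso_def)
qed

context universal_bg
begin

interpretation End: monoid "bg_End B" by (rule monoid_End)

text \<open>Embed the disjoint union of \<open>A\<close> and an infinite set of isolated vertices, all with the colour of
  \<open>x1\<close> and \<open>x2\<close>; retracting each isolated vertex to either \<open>x1\<close> or \<open>x2\<close> gives the continuum many
  idempotents.\<close>

lemma idempotents_with_image:
  fixes A :: "'x bgraph" and d :: "'x \<Rightarrow> bool"
  assumes cnt: "countable (bverts A)" and gr: "graph (bverts A) (bedges A)"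
    and part: "bpart A = {(u, v). u \<in> bverts A \<and> v \<in> bverts A \<and> d u = d v}"
    and col: "\<And>u v. (u, v) \<in> bedges A \<Longrightarrow> d u \<noteq> d v"
    and dom: "finitely_dominated (bedges A) d (bverts A)"
    and x: "x1 \<in> bverts A" "x2 \<in> bverts A" "x1 \<noteq> x2" "d x1 = d x2"
  shows "\<exists>e :: nat set \<Rightarrow> 'v \<Rightarrow> 'v. inj e \<and>
    (\<forall>S. e S \<in> idempotents (bg_End B) \<and> bg_isomorphic A (bg_image B (e S)))"
proof -
  have bipA: "bipartite_graph A"
    unfolding bipartite_graph_iff_colouring using gr part col by blast
  define X where "X = Inl ` bverts A \<union> range (Inr :: nat \<Rightarrow> 'x + nat)"
  define adj where "adj p q \<longleftrightarrow> (\<exists>u v. p = Inl u \<and> q = Inl v \<and> (u, v) \<in> bedges A)" for p q :: "'x + nat"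
  define d' where "d' = case_sum d (\<lambda>_::nat. d x1)"
  have "countable X" using cnt by (simp add: X_def)
  moreover have "adj p q \<Longrightarrow> adj q p" "adj p q \<Longrightarrow> d' p \<noteq> d' q" for p q
    using gr col by (auto simp: adj_def d'_def graph_def sym_def)
  ultimately obtain \<phi> where \<phi>: "inj_on \<phi> X" "\<phi> ` X \<subseteq> bverts B" "\<forall>p\<in>X. c (\<phi> p) = d' p"
    "\<forall>p\<in>X. \<forall>q\<in>X. (\<phi> p, \<phi> q) \<in> bedges B \<longleftrightarrow> adj p q"
    "\<forall>v\<in>bverts B - \<phi> ` X. finite {p \<in> X. (v, \<phi> p) \<in> bedges B}"
    using sparse_embedding [of X adj d'] by blast
  define \<psi> where "\<psi> u = \<phi> (Inl u)" for u
  have InX: "Inl u \<in> X" if "u \<in> bverts A" for u using that by (simp add: X_def)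
  have InrX: "Inr n \<in> X" for n by (simp add: X_def)
  have \<psi>_inj: "inj_on \<psi> (bverts A)"
    using \<phi>(1) InX by (auto simp: \<psi>_def inj_on_def)
  have \<psi>c: "c (\<psi> u) = d u" if "u \<in> bverts A" for u
    using \<phi>(3) InX [OF that] by (simp add: \<psi>_def d'_def)
  have \<psi>E: "(\<psi> u, \<psi> v) \<in> bedges B \<longleftrightarrow> (u, v) \<in> bedges A" if "u \<in> bverts A" "v \<in> bverts A" for u v
    using \<phi>(4) InX [OF that(1)] InX [OF that(2)] by (simp add: \<psi>_def adj_def)
  define T where "T = \<psi> ` bverts A"
  have TV: "T \<subseteq> bverts B" using \<phi>(2) InX by (auto simp: T_def \<psi>_def)
  have domT: "finitely_dominated (bedges B) c T"
    unfolding finitely_dominated_def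
  proof (intro allI impI)
    fix U k assume U: "finite U" "U \<subseteq> T" "\<forall>u\<in>U. c u = k"
    obtain U' where U': "U' \<subseteq> bverts A" "finite U'" "U = \<psi> ` U'"
      using finite_subset_image [OF U(1) U(2) [unfolded T_def]] by blast
    have "\<forall>u\<in>U'. d u = k" using U(3) U'(1,3) \<psi>c by auto
    then obtain t where t: "t \<in> bverts A" "d t \<noteq> k" "\<forall>u\<in>U'. (t, u) \<in> bedges A"
      using finitely_dominatedD [OF dom U'(2,1)] by blast
    have "\<forall>u\<in>U. (\<psi> t, u) \<in> bedges B" using t(1,3) U'(1,3) \<psi>E by auto
    then show "\<exists>t\<in>T. c t \<noteq> k \<and> (\<forall>u\<in>U. (t, u) \<in> bedges B)"
      using t(1,2) \<psi>c by (intro bexI [of _ "\<psi> t"]) (auto simp: T_def)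
  qed
  have "\<exists>e\<in>idempotents (bg_End B). bg_isomorphic A (bg_image B e) \<and>
    (\<forall>n. e (\<phi> (Inr n)) = \<psi> (if n \<in> S then x1 else x2))" for S
  proof -
    define \<rho> where "\<rho> = case_sum \<psi> (\<lambda>n. \<psi> (if n \<in> S then x1 else x2))"
    define g where "g y = \<rho> (inv_into X \<phi> y)" for y
    have g: "g (\<phi> p) = \<rho> p" if "p \<in> X" for p using \<phi>(1) that by (simp add: g_def)
    have \<rho>T: "\<rho> p \<in> T" and \<rho>c: "c (\<rho> p) = d' p" if "p \<in> X" for p
      using that x \<psi>c by (auto simp: X_def \<rho>_def T_def d'_def split: if_split_asm)
    have fin: "finite {y \<in> \<phi> ` X. (v, y) \<in> bedges B}" if "v \<in> bverts B - \<phi> ` X" for v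
    proof -
      have "{y \<in> \<phi> ` X. (v, y) \<in> bedges B} = \<phi> ` {p \<in> X. (v, \<phi> p) \<in> bedges B}" by auto
      then show ?thesis using \<phi>(5) that by simp
    qed
    have "\<exists>h\<in>carrier (bg_End B). h ` bverts B \<subseteq> T \<and> (\<forall>y\<in>\<phi> ` X. h y = g y)"
    proof (rule extend_to_endomorphism [OF \<phi>(2) TV domT])
      show "g ` \<phi> ` X \<subseteq> T" using g \<rho>T by auto
      show "c (g y) = c y" if "y \<in> \<phi> ` X" for y using that g \<rho>c \<phi>(3) by auto
      show "(g y, g z) \<in> bedges B" if yz: "y \<in> \<phi> ` X" "z \<in> \<phi> ` X" "(y, z) \<in> bedges B" for y z
      proof -
        obtain p q where pq: "p \<in> X" "q \<in> X" "y = \<phi> p" "z = \<phi> q" using yz by blast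
        then have "adj p q" using \<phi>(4) yz(3) by blast
        \<comment> \<open>The added vertices are isolated, so every edge inside the embedded copy
          joins vertices of \<open>A\<close>, which \<open>g\<close> fixes; the free choice of
          values on the added vertices meets no edge constraint.\<close>
        then obtain u v where uv: "p = Inl u" "q = Inl v" by (auto simp: adj_def)
        then have "g y = y" "g z = z" using pq g by (simp_all add: \<rho>_def \<psi>_def)
        then show ?thesis using yz(3) by simp
      qed
    qed (rule fin)
    then obtain h where h: "h \<in> carrier (bg_End B)" "h ` bverts B \<subseteq> T" "\<And>p. p \<in> X \<Longrightarrow> h (\<phi> p) = \<rho> p"
      using g by auto
    have hT: "h t = t" if "t \<in> T" for t using that h(3) InX by (auto simp: T_def \<psi>_def \<rho>_def)
    have e: "h \<in> idempotents (bg_End B)" unfolding idempotent_iff using h(1,2) hT by blast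
    have im: "h ` bverts B = T" using h(2) hT TV by force
    have "bg_iso A (bg_image B h) \<psi>"
      unfolding iso_idempotent_image_iff [OF bipA e] im
      using \<psi>_inj \<psi>E \<psi>c by (auto simp: bij_betw_def T_def part)
    moreover have "h (\<phi> (Inr n)) = \<psi> (if n \<in> S then x1 else x2)" for n
      using h(3) [OF InrX] by (simp add: \<rho>_def)
    ultimately show ?thesis using e by (auto simp: bg_isomorphic_def)
  qed
  then obtain e where e: "\<And>S. e S \<in> idempotents (bg_End B)" "\<And>S. bg_isomorphic A (bg_image B (e S))"
    "\<And>S n. e S (\<phi> (Inr n)) = \<psi> (if n \<in> S then x1 else x2)" by metis
  have ne: "\<psi> x1 \<noteq> \<psi> x2" using \<psi>_inj x by (auto dest: inj_onD)
  have "inj e"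
  proof (rule injI)
    fix S S' assume "e S = e S'"
    then have "\<psi> (if n \<in> S then x1 else x2) = \<psi> (if n \<in> S' then x1 else x2)" for n
      using e(3) [of S n] e(3) [of S' n] by simp
    then have "n \<in> S \<longleftrightarrow> n \<in> S'" for n using ne by (metis (full_types))
    then show "S = S'" by blast
  qed
  then show ?thesis using e(1,2) by blast
qed

text \<open>An endomorphism of a countable graph is coded by its graph, a set of codes of pairs of
  naturals. This is the upper bound in (i) and (ii).\<close>

lemma End_lepoll: "carrier (bg_End B) \<lesssim> (UNIV :: nat set set)"
proof -
  define iv where "iv = to_nat_on (bverts B)"
  have iv: "inj_on iv (bverts B)" using countable_verts by (simp add: iv_def inj_on_to_nat_on)
  have "inj_on (\<lambda>f. (\<lambda>x. prod_encode (iv x, iv (f x))) ` bverts B) (carrier (bg_End B))"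
  proof (rule inj_onI)
    fix f g assume f: "f \<in> carrier (bg_End B)" and g: "g \<in> carrier (bg_End B)"
      and eq: "(\<lambda>x. prod_encode (iv x, iv (f x))) ` bverts B = (\<lambda>x. prod_encode (iv x, iv (g x))) ` bverts B"
    show "f = g"
    proof (rule End_eqI [OF f g])
      fix x assume x: "x \<in> bverts B"
      then have "prod_encode (iv x, iv (f x)) \<in> (\<lambda>x. prod_encode (iv x, iv (g x))) ` bverts B"
        using eq by blast
      then obtain y where y: "y \<in> bverts B" "iv x = iv y" "iv (f x) = iv (g y)" by auto
      then have "x = y" using iv x by (auto dest: inj_onD)
      then show "f x = g x" using y iv End_closed [OF f x] End_closed [OF g x] by (auto dest: inj_onD)
    qed
  qed
  then show ?thesis unfolding lepoll_def by blast
qed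

text \<open>Having at most one vertex of each colour suffices because domination supplies the rest:
  applied to the empty set it gives both colours, applied to a single vertex it gives the
  edge.\<close>

lemma isomorphic_K11_iff:
  assumes e: "e \<in> idempotents (bg_End B)"
  shows "bg_isomorphic (bg_image B e) K11 \<longleftrightarrow> inj_on c (e ` bverts B)"
proof
  assume "bg_isomorphic (bg_image B e) K11"
  then obtain \<theta> where "bg_iso (bg_image B e) K11 \<theta>" by (auto simp: bg_isomorphic_def)
  then have "inj_on \<theta> (e ` bverts B)" and
    "\<And>u v. u \<in> e ` bverts B \<Longrightarrow> v \<in> e ` bverts B \<Longrightarrow> c u = c v \<Longrightarrow> (\<theta> u, \<theta> v) \<in> bpart K11"
    unfolding bg_iso_iff [OF bipartite_idempotent_image [OF e] bipartite_graph_K11]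
      idempotent_image_sel [OF e] by (auto simp: bij_betw_def)
  then show "inj_on c (e ` bverts B)" by (fastforce simp: K11_def intro!: inj_onI dest: inj_onD)
next
  let ?T = "e ` bverts B"
  assume inj: "inj_on c ?T"
  have dom: "finitely_dominated (bedges B) c ?T" by (rule finitely_dominated_idempotent_image [OF e])
  have "k \<in> c ` ?T" for k
  proof -
    obtain t where t: "t \<in> ?T" "c t \<noteq> (\<not> k)" by (rule finitely_dominatedD [OF dom, of "{}" "\<not> k"]) auto
    then have "k = c t" by simp
    then show ?thesis using t(1) by (rule image_eqI)
  qed
  then have "c ` ?T = UNIV" by blast
  then have bij: "bij_betw c ?T UNIV" using inj by (simp add: bij_betw_def)
  have edge: "(u, v) \<in> bedges B" if uv: "u \<in> ?T" "v \<in> ?T" "c u \<noteq> c v" for u v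
  proof -
    obtain t where t: "t \<in> ?T" "c t \<noteq> c u" "(t, u) \<in> bedges B"
      using finitely_dominatedD [OF dom, of "{u}" "c u"] uv(1) by auto
    then have "t = v" using inj uv by (auto dest: inj_onD)
    then show ?thesis using t(3) edge_sym by blast
  qed
  have "bg_iso (bg_image B e) K11 c"
    unfolding bg_iso_iff [OF bipartite_idempotent_image [OF e] bipartite_graph_K11]
      idempotent_image_sel [OF e] K11_sel
  proof (intro conjI ballI)
    fix u v assume "u \<in> ?T" "v \<in> ?T"
    then show "c u \<noteq> c v \<longleftrightarrow> (u, v) \<in> bedges B \<inter> ?T \<times> ?T" using edge edge_colours by blast
    show "c u = c v \<longleftrightarrow> (u, v) \<in> {(u, v). u \<in> ?T \<and> v \<in> ?T \<and> c u = c v}"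
      using \<open>u \<in> ?T\<close> \<open>v \<in> ?T\<close> by blast
  qed (rule bij)
  then show "bg_isomorphic (bg_image B e) K11" by (auto simp: bg_isomorphic_def)
qed

text \<open>The image of \<open>f\<close> is itself dominated, so it can be re-embedded as the image
  of continuum many idempotents; the failure of \<open>c\<close> to be injective on it provides the
  two retraction targets of one colour.\<close>

lemma green_D_class_eqpoll:
  assumes f: "f \<in> idempotents (bg_End B)" and K: "\<not> bg_isomorphic (bg_image B f) K11"
  shows "group_H_classes_in (bg_End B) (green_D (bg_End B) `` {f}) \<approx> (UNIV :: nat set set)"
proof -
  let ?I = "{e \<in> idempotents (bg_End B). (f, e) \<in> green_D (bg_End B)}"
  have bipf: "bipartite_graph (bg_image B f)" by (rule bipartite_idempotent_image [OF f])
  obtain x1 x2 where x: "x1 \<in> f ` bverts B" "x2 \<in> f ` bverts B" "x1 \<noteq> x2" "c x1 = c x2"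
    using K unfolding isomorphic_K11_iff [OF f] inj_on_def by blast
  have "\<exists>e :: nat set \<Rightarrow> 'v \<Rightarrow> 'v. inj e \<and>
    (\<forall>S. e S \<in> idempotents (bg_End B) \<and> bg_isomorphic (bg_image B f) (bg_image B (e S)))"
  proof (rule idempotents_with_image [of _ c x1 x2])
    have "finitely_dominated (bedges B) c (f ` bverts B)"
      by (rule finitely_dominated_idempotent_image [OF f])
    then show "finitely_dominated (bedges (bg_image B f)) c (bverts (bg_image B f))"
      unfolding idempotent_image_sel [OF f] by (rule finitely_dominated_restrict)
    show "Defs.graph (bverts (bg_image B f)) (bedges (bg_image B f))"
      using bipf by (simp add: bipartite_graph_def)
  qed (use x countable_verts edge_colours in \<open>auto simp: idempotent_image_sel [OF f]\<close>)
  then obtain e :: "nat set \<Rightarrow> 'v \<Rightarrow> 'v" where "inj e" "range e \<subseteq> ?I"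
    using green_D_idempotents_iff_isomorphic [OF f] by blast
  then have "(UNIV :: nat set set) \<lesssim> ?I" unfolding lepoll_def by blast
  moreover have "?I \<subseteq> carrier (bg_End B)" by (auto simp: idempotents_def)
  then have "?I \<lesssim> (UNIV :: nat set set)" using End_lepoll by (meson lepoll_trans subset_imp_lepoll)
  ultimately have "?I \<approx> (UNIV :: nat set set)" by (rule lepoll_antisym [rotated])
  moreover have "f \<in> carrier (bg_End B)" using f by (simp add: idempotents_def)
  ultimately show ?thesis using End.group_H_classes_in_green_D eqpoll_trans by blast
qed

text \<open>Collapsing each part onto the endpoint of its colour is a homomorphism, because every
  edge of \<open>B\<close> joins the two parts.\<close>

lemma K11_idempotent_of_edge:
  assumes uv: "(u, v) \<in> bedges B"
  obtains e where "e \<in> idempotents (bg_End B)" "e ` bverts B = {u, v}"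
    "bg_isomorphic (bg_image B e) K11"
proof -
  define e where "e = (\<lambda>x\<in>bverts B. if c x = c u then u else v)"
  have V: "u \<in> bverts B" "v \<in> bverts B" using edge_verts [OF uv] by auto
  have ne: "c v \<noteq> c u" using edge_colours [OF uv] by auto
  have "e \<in> carrier (bg_End B)"
  proof (rule EndI)
    fix x y assume xy: "(x, y) \<in> bedges B"
    then show "(e x, e y) \<in> bedges B"
      using edge_verts [OF xy] edge_colours [OF xy] uv edge_sym [OF uv] by (auto simp: e_def)
  qed (use V in \<open>auto simp: e_def\<close>)
  then have e: "e \<in> idempotents (bg_End B)" unfolding idempotent_iff using V ne by (auto simp: e_def)
  have im: "e ` bverts B = {u, v}"
    using V ne by (auto simp: e_def image_iff)
  moreover have "inj_on c {u, v}" using ne by auto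
  ultimately show ?thesis using that [OF e] isomorphic_K11_iff [OF e] by simp
qed

text \<open>An idempotent preserves colours, so when its image has one vertex per colour, the image
  determines it; countability follows from that of the finite vertex sets. Infinitely many arise
  because a vertex has neighbours outside every finite set.\<close>

lemma K11_idempotents_eqpoll:
  "{e \<in> idempotents (bg_End B). bg_isomorphic (bg_image B e) K11} \<approx> (UNIV :: nat set)" (is "?K \<approx> _")
proof -
  have K: "e \<in> ?K \<longleftrightarrow> e \<in> idempotents (bg_End B) \<and> inj_on c (e ` bverts B)" for e
    using isomorphic_K11_iff by auto
  have fin: "finite (e ` bverts B)" if "e \<in> ?K" for e
    using that unfolding K by (metis finite finite_imageD)
  have "inj_on (\<lambda>e. e ` bverts B) ?K"
  proof (rule inj_onI)
    fix e e' assume e: "e \<in> ?K" "e' \<in> ?K" "e ` bverts B = e' ` bverts B"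
    then have ie: "e \<in> idempotents (bg_End B)" "e' \<in> idempotents (bg_End B)" "inj_on c (e ` bverts B)"
      unfolding K by auto
    show "e = e'"
    proof (rule End_eqI)
      fix x assume x: "x \<in> bverts B"
      then have "e x \<in> e ` bverts B" "e' x \<in> e ` bverts B" using e(3) by auto
      moreover have "c (e x) = c (e' x)" using idempotent_colour [OF _ x] ie by metis
      ultimately show "e x = e' x" using ie(3) by (auto dest: inj_onD)
    qed (use ie in \<open>auto simp: idempotents_def\<close>)
  qed
  moreover have "(\<lambda>e. e ` bverts B) ` ?K \<subseteq> {F. finite F \<and> F \<subseteq> bverts B}"
    using fin idempotent_image_subset by auto
  then have "countable ((\<lambda>e. e ` bverts B) ` ?K)"
    by (rule countable_subset) (rule countable_Collect_finite_subset [OF countable_verts])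
  ultimately have cnt: "countable ?K" by (rule countable_image_inj_on [rotated])
  have "infinite ?K"
  proof
    assume "finite ?K"
    then have W: "finite (\<Union>e\<in>?K. e ` bverts B)" using fin by blast
    have WV: "(\<Union>e\<in>?K. e ` bverts B) \<subseteq> bverts B" using idempotent_image_subset by auto
    obtain u where u: "u \<in> bverts B" using extension [of "{}" "{}" True] by auto
    obtain v where v: "v \<notin> (\<Union>e\<in>?K. e ` bverts B)" "(v, u) \<in> bedges B"
      \<comment> \<open>The union of the finitely many images is put into \<open>W\<close>, so the
        new edge at \<open>u\<close> yields an idempotent missing from the supposedly finite
        set.\<close>
      using extension [of "{u}" "\<Union>e\<in>?K. e ` bverts B" "c u"] W WV u by blast
    obtain e where e: "e \<in> idempotents (bg_End B)" "e ` bverts B = {v, u}"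
      "bg_isomorphic (bg_image B e) K11" by (rule K11_idempotent_of_edge [OF v(2)])
    then have "v \<in> e ` bverts B" by simp
    then show False using v(1) e(1,3) by blast
  qed
  then have "(UNIV :: nat set) \<approx> ?K" unfolding eqpoll_def using bij_betw_from_nat_into [OF cnt] by blast
  then show ?thesis by (rule eqpoll_sym)
qed

end

section \<open>Coding a graph and a set of naturals\<close>

text \<open>A bipartite graph coding a graph \<open>(V, E)\<close> and a set \<open>S\<close> of natural numbers.  One part consists of
  the points, the other of a family of blocks, and a point is joined to the blocks that do \<^emph>\<open>not\<close>
  contain it.  The finite initial segments of the naturals make these points rigid, and the only
  infinite block records \<open>S\<close>; it is coinfinite, which keeps the graph finitely dominated.\<close>

definition points :: "'w set \<Rightarrow> (nat + 'w) set" where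
  "points V = range Inl \<union> Inr ` V"

text \<open>The residues modulo 3 have separate tasks: residue 0 always belongs, making the set
  infinite; residue 1 records \<open>S\<close>; residue 2 never belongs, making it coinfinite in a
  way that does not depend on \<open>S\<close>.\<close>

definition code :: "nat set \<Rightarrow> nat set" where
  "code S = {n. n mod 3 = 0 \<or> n mod 3 = 1 \<and> n div 3 \<in> S}"

text \<open>The segment with \<open>k = 0\<close> is the empty block, which is joined to every
  point. The singletons ensure that each vertex of the coded graph lies in some block, even an
  isolated one; longer segments do this for the naturals. So no point is joined to every block, and
  the parts can be told apart.\<close>

definition blocks :: "'w set \<Rightarrow> ('w \<times> 'w) set \<Rightarrow> nat set \<Rightarrow> (nat + 'w) set set" where
  "blocks V E S = range (\<lambda>k. Inl ` {..<k}) \<union> {Inl ` code S} \<union> (\<lambda>w. {Inr w}) ` V \<union>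
     (\<lambda>(u, v). {Inr u, Inr v}) ` E"

definition block_edges :: "'w set \<Rightarrow> ('w \<times> 'w) set \<Rightarrow> nat set \<Rightarrow>
    (((nat + 'w) + (nat + 'w) set) \<times> ((nat + 'w) + (nat + 'w) set)) set" where
  "block_edges V E S = {(Inl p, Inr b) |p b. p \<in> points V \<and> b \<in> blocks V E S \<and> p \<notin> b} \<union>
     {(Inr b, Inl p) |p b. p \<in> points V \<and> b \<in> blocks V E S \<and> p \<notin> b}"

definition block_graph :: "'w set \<Rightarrow> ('w \<times> 'w) set \<Rightarrow> nat set \<Rightarrow> ((nat + 'w) + (nat + 'w) set) bgraph" where
  "block_graph V E S = \<lparr>bverts = Inl ` points V \<union> Inr ` blocks V E S, bedges = block_edges V E S,
     bpart = {(x, y). x \<in> Inl ` points V \<union> Inr ` blocks V E S \<and>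
       y \<in> Inl ` points V \<union> Inr ` blocks V E S \<and> isl x = isl y}\<rparr>"

lemma infinite_code: "infinite (code S)"
proof
  assume "finite (code S)"
  moreover have "range (\<lambda>n. 3 * n) \<subseteq> code S" by (auto simp: code_def)
  ultimately have "finite (range (\<lambda>n::nat. 3 * n))" by (rule rev_finite_subset)
  then show False by (rule range_inj_infinite [THEN notE, rotated]) (simp add: inj_def)
qed

lemma code_inj:
  assumes "code S = code S'"
  shows "S = S'"
proof (rule Set.set_eqI)
  fix n
  have "3 * n + 1 \<in> code S \<longleftrightarrow> 3 * n + 1 \<in> code S'" using assms by simp
  moreover have "(3 * n + 1) mod 3 = 1" "(3 * n + 1) div 3 = n" by presburger+
  ultimately show "n \<in> S \<longleftrightarrow> n \<in> S'" by (simp add: code_def)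
qed

lemma blocksE:
  assumes "b \<in> blocks V E S"
  obtains (initial) k where "b = Inl ` {..<k}" | (code) "b = Inl ` code S"
    | (vertex) w where "w \<in> V" "b = {Inr w}" | (edge) u v where "(u, v) \<in> E" "b = {Inr u, Inr v}"
  using assms unfolding blocks_def by blast

lemma initial_in_blocks: "Inl ` {..<k} \<in> blocks V E S" by (auto simp: blocks_def)

lemma code_in_blocks: "Inl ` code S \<in> blocks V E S" by (auto simp: blocks_def)

lemma empty_in_blocks: "{} \<in> blocks V E S"
  using initial_in_blocks [of 0] by simp

lemma blocks_subset_points: "graph V E \<Longrightarrow> b \<in> blocks V E S \<Longrightarrow> b \<subseteq> points V"
  by (auto simp: blocks_def points_def graph_def)

lemma point_in_block:
  assumes "p \<in> points V"
  obtains b where "b \<in> blocks V E S" "p \<in> b"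
proof (cases p)
  case (Inl n)
  then show ?thesis using that [OF initial_in_blocks [of "Suc n"]] by simp
next
  case (Inr w)
  then have "w \<in> V" using assms by (auto simp: points_def)
  then show ?thesis using that [of "{Inr w}"] Inr by (auto simp: blocks_def)
qed

text \<open>The bound 3 excludes the vertex and edge blocks, which have at most two points.\<close>

lemma large_block_subset:
  assumes "b \<in> blocks V E S" "card b \<ge> 3"
  shows "b \<subseteq> range Inl"
  using assms(1)
proof (cases rule: blocksE)
  case (edge u v)
  then show ?thesis using assms(2) card_insert_le_m1 [of 2 "{Inr v :: nat + 'a}" "Inr u"] by simp
qed (use assms(2) in auto)

lemma finite_block_eq_initial:
  assumes "b \<in> blocks V E S" "finite b" "b \<subseteq> range Inl"
  shows "b = Inl ` {..<card b}"
  using assms(1)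
proof (cases rule: blocksE)
  case (initial k)
  then show ?thesis by (simp add: card_image)
next
  case code
  then have "finite (code S)" using assms(2) finite_imageD [of Inl "code S"] by simp
  then show ?thesis using infinite_code by blast
qed (use assms(3) in auto)

lemma infinite_block_eq_code: "b \<in> blocks V E S \<Longrightarrow> infinite b \<Longrightarrow> b = Inl ` code S"
  by (erule blocksE) auto

text \<open>Lets the edge relation be recovered from the blocks. Distinctness matters because for
  \<open>u = v\<close> the set collapses to a vertex block.\<close>

lemma pair_block_iff:
  assumes "graph V E" "u \<noteq> v"
  shows "{Inr u, Inr v} \<in> blocks V E S \<longleftrightarrow> (u, v) \<in> E"
proof
  assume "{Inr u, Inr v} \<in> blocks V E S"
  then show "(u, v) \<in> E"
  proof (cases rule: blocksE)
    case (edge u' v')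
    then show ?thesis using assms by (auto simp: doubleton_eq_iff graph_def sym_def)
  next
    case (initial k)
    then have "Inr u \<in> (Inl ` {..<k} :: (nat + 'a) set)" by blast
    then show ?thesis by auto
  next
    case code
    then have "Inr u \<in> (Inl ` code S :: (nat + 'a) set)" by blast
    then show ?thesis by auto
  next
    case (vertex w)
    then show ?thesis using assms(2) by auto
  qed
qed (auto simp: blocks_def)

section \<open>The coding graph is a countable, finitely dominated bipartite graph\<close>

lemma block_graph_sel:
  "bverts (block_graph V E S) = Inl ` points V \<union> Inr ` blocks V E S"
  "bedges (block_graph V E S) = block_edges V E S"
  "bpart (block_graph V E S) = {(x, y). x \<in> bverts (block_graph V E S) \<and>
     y \<in> bverts (block_graph V E S) \<and> isl x = isl y}"
  by (simp_all add: block_graph_def)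

lemma block_verts_iff:
  "Inl p \<in> bverts (block_graph V E S) \<longleftrightarrow> p \<in> points V"
  "Inr b \<in> bverts (block_graph V E S) \<longleftrightarrow> b \<in> blocks V E S"
  by (auto simp: block_graph_sel)

lemma block_edges_iff:
  "(Inl p, Inr b) \<in> block_edges V E S \<longleftrightarrow> p \<in> points V \<and> b \<in> blocks V E S \<and> p \<notin> b"
  "(Inr b, Inl p) \<in> block_edges V E S \<longleftrightarrow> p \<in> points V \<and> b \<in> blocks V E S \<and> p \<notin> b"
  "(Inl p, Inl q) \<notin> block_edges V E S" "(Inr b, Inr b') \<notin> block_edges V E S"
  by (auto simp: block_edges_def)

lemma graph_block_graph: "graph (bverts (block_graph V E S)) (bedges (block_graph V E S))"
  unfolding graph_def block_graph_sel by (auto simp: block_edges_def irrefl_def sym_def)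

lemma block_edges_colours: "(x, y) \<in> bedges (block_graph V E S) \<Longrightarrow> isl x \<noteq> isl y"
  by (auto simp: block_graph_sel block_edges_def)

lemma bipartite_block_graph: "bipartite_graph (block_graph V E S)"
  unfolding bipartite_graph_iff_colouring
  by (intro conjI exI [of _ isl] allI impI graph_block_graph block_graph_sel(3) block_edges_colours)

lemma countable_block_graph:
  assumes "graph V E" "countable V"
  shows "countable (bverts (block_graph V E S))"
proof -
  have "E \<subseteq> V \<times> V" using assms(1) by (simp add: graph_def)
  then have "countable E" by (rule countable_subset) (simp add: assms(2))
  then show ?thesis using assms(2) by (auto simp: block_graph_sel points_def blocks_def)
qed

text \<open>A set of points is dominated by the empty block. For finitely many blocks, the point
  \<open>3 * n + 2\<close> with \<open>n\<close> large avoids them all: initial segments are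
  bounded, \<open>code S\<close> omits residue 2, and the other blocks contain no naturals.\<close>

lemma finitely_dominated_block_graph:
  "finitely_dominated (bedges (block_graph V E S)) isl (bverts (block_graph V E S))"
  unfolding finitely_dominated_def
proof (intro allI impI)
  fix U k
  assume U: "finite U" "U \<subseteq> bverts (block_graph V E S)" "\<forall>u\<in>U. isl u = k"
  show "\<exists>t\<in>bverts (block_graph V E S). isl t \<noteq> k \<and> (\<forall>u\<in>U. (t, u) \<in> bedges (block_graph V E S))"
  proof (cases k)
    case True
    have "(Inr {}, u) \<in> bedges (block_graph V E S)" if "u \<in> U" for u
      using that U(2,3) True empty_in_blocks [of V E S]
      by (cases u) (auto simp: block_graph_sel(2) block_edges_iff block_verts_iff dest!: subsetD)
    then show ?thesis using empty_in_blocks [of V E S] True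
      by (intro bexI [of _ "Inr {}"]) (auto simp: block_verts_iff)
  next
    case False
    have Ub: "\<exists>b\<in>blocks V E S. u = Inr b" if "u \<in> U" for u
      using that U(2,3) False by (cases u) (auto simp: block_verts_iff dest!: subsetD)
    have "\<exists>m. \<forall>n\<ge>m. Inl (3 * n + 2) \<notin> b" if "b \<in> blocks V E S" for b
      using that
    proof (cases rule: blocksE)
      case (initial k)
      then show ?thesis by (intro exI [of _ k]) auto
    next
      case code
      have "(3 * n + 2) mod 3 = (2::nat)" for n by presburger
      then have "3 * n + 2 \<notin> code S" for n unfolding code_def by simp
      then show ?thesis using code by (auto simp: inj_image_mem_iff)
    qed auto
    then have "\<forall>u\<in>U. \<exists>m. \<forall>n\<ge>m. Inl (3 * n + 2) \<notin> projr u" using Ub by fastforce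
    then obtain m where m: "\<forall>u\<in>U. \<forall>n\<ge>m u. Inl (3 * n + 2) \<notin> projr u" by metis
    have "\<forall>u\<in>U. m u \<le> Max (m ` U)" using U(1) by simp
    then have "\<forall>u\<in>U. Inl (3 * Max (m ` U) + 2) \<notin> projr u" using m by blast
    then have "(Inl (Inl (3 * Max (m ` U) + 2)), u) \<in> bedges (block_graph V E S)" if "u \<in> U" for u
      using that Ub [OF that] by (auto simp: block_graph_sel(2) block_edges_iff points_def)
    then show ?thesis using False
      by (intro bexI [of _ "Inl (Inl (3 * Max (m ` U) + 2))"]) (auto simp: block_verts_iff points_def)
  qed
qed

text \<open>An isomorphism preserves \<open>bpart\<close>, so it either keeps or swaps the two
  colours throughout; following the single vertex \<open>Inr {}\<close> decides which.\<close>

lemma block_graph_iso_respects_isl: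
  assumes \<sigma>: "bg_iso (block_graph V E S) (block_graph V E S') \<sigma>" and x: "x \<in> bverts (block_graph V E S)"
  shows "isl (\<sigma> x) = isl x"
proof -
  have bij: "bij_betw \<sigma> (bverts (block_graph V E S)) (bverts (block_graph V E S'))"
    and E: "\<And>x y. x \<in> bverts (block_graph V E S) \<Longrightarrow> y \<in> bverts (block_graph V E S) \<Longrightarrow>
      (\<sigma> x, \<sigma> y) \<in> block_edges V E S' \<longleftrightarrow> (x, y) \<in> block_edges V E S"
    and P: "\<And>x y. x \<in> bverts (block_graph V E S) \<Longrightarrow> y \<in> bverts (block_graph V E S) \<Longrightarrow>
      (\<sigma> x, \<sigma> y) \<in> bpart (block_graph V E S') \<longleftrightarrow> (x, y) \<in> bpart (block_graph V E S)"
    using \<sigma> unfolding bg_iso_iff [OF bipartite_block_graph bipartite_block_graph] block_graph_sel(2) by auto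
  have \<sigma>V: "\<sigma> y \<in> bverts (block_graph V E S')" if "y \<in> bverts (block_graph V E S)" for y
    using bij that by (auto simp: bij_betw_def)
  have same: "isl (\<sigma> y) = isl (\<sigma> z) \<longleftrightarrow> isl y = isl z"
    if "y \<in> bverts (block_graph V E S)" "z \<in> bverts (block_graph V E S)" for y z
    using P [OF that] \<sigma>V [OF that(1)] \<sigma>V [OF that(2)] that unfolding block_graph_sel(3) by simp
  have e: "Inr {} \<in> bverts (block_graph V E S)" using empty_in_blocks by (simp add: block_verts_iff)
  have "\<not> isl (\<sigma> (Inr {}))"
  proof
    \<comment> \<open>The empty block is joined to all points, but no point is joined to all blocks.\<close>
    assume l: "isl (\<sigma> (Inr {}))"
    then obtain q where q: "\<sigma> (Inr {}) = Inl q" "q \<in> points V"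
      using \<sigma>V [OF e] by (cases "\<sigma> (Inr {})") (auto simp: block_verts_iff)
    obtain b where b: "b \<in> blocks V E S'" "q \<in> b" by (rule point_in_block [OF q(2)])
    then have "Inr b \<in> \<sigma> ` bverts (block_graph V E S)"
      using bij by (simp add: bij_betw_def block_verts_iff)
    then obtain y where y: "y \<in> bverts (block_graph V E S)" "\<sigma> y = Inr b" by force
    then have "isl y" using same [OF y(1) e] l by auto
    then obtain p where "y = Inl p" "p \<in> points V" using y(1) by (cases y) (auto simp: block_verts_iff)
    then have "(\<sigma> y, \<sigma> (Inr {})) \<in> block_edges V E S'"
      using E [OF y(1) e] empty_in_blocks by (simp add: block_edges_iff)
    then show False using y(2) q b by (simp add: block_edges_iff)
  qed
  then show ?thesis using same [OF x e] by auto
qed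

text \<open>A block is determined by the points it is not joined to, so an isomorphism is governed
  by its action \<open>\<pi>\<close> on points and sends each block to its image under
  \<open>\<pi>\<close>.\<close>

lemma block_graph_iso_on_points:
  assumes gr: "graph V E" and \<sigma>: "bg_iso (block_graph V E S) (block_graph V E S') \<sigma>"
  obtains \<pi> where "bij_betw \<pi> (points V) (points V)" "\<forall>p\<in>points V. \<sigma> (Inl p) = Inl (\<pi> p)"
    "\<forall>b\<in>blocks V E S. \<sigma> (Inr b) = Inr (\<pi> ` b)" "(`) \<pi> ` blocks V E S = blocks V E S'"
proof -
  let ?W = "bverts (block_graph V E S)" and ?W' = "bverts (block_graph V E S')"
  have bij: "bij_betw \<sigma> ?W ?W'"
    and E: "\<And>x y. x \<in> ?W \<Longrightarrow> y \<in> ?W \<Longrightarrow> (\<sigma> x, \<sigma> y) \<in> block_edges V E S' \<longleftrightarrow> (x, y) \<in> block_edges V E S"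
    using \<sigma> unfolding bg_iso_iff [OF bipartite_block_graph bipartite_block_graph] block_graph_sel(2) by auto
  have inj: "inj_on \<sigma> ?W" and onto: "\<sigma> ` ?W = ?W'" using bij by (auto simp: bij_betw_def)
  have W: "Inl p \<in> ?W \<longleftrightarrow> p \<in> points V" "Inr b \<in> ?W \<longleftrightarrow> b \<in> blocks V E S"
    "Inl p \<in> ?W' \<longleftrightarrow> p \<in> points V" "Inr b \<in> ?W' \<longleftrightarrow> b \<in> blocks V E S'" for p b
    by (simp_all add: block_verts_iff)
  note isl = block_graph_iso_respects_isl [OF \<sigma>]
  define \<pi> where "\<pi> p = projl (\<sigma> (Inl p))" for p
  define \<beta> where "\<beta> b = projr (\<sigma> (Inr b))" for b
  have \<pi>: "\<sigma> (Inl p) = Inl (\<pi> p)" if "p \<in> points V" for p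
    using isl [of "Inl p"] that W by (simp add: \<pi>_def)
  have \<beta>: "\<sigma> (Inr b) = Inr (\<beta> b)" if "b \<in> blocks V E S" for b
    using isl [of "Inr b"] that W by (simp add: \<beta>_def)
  have \<pi>V: "\<pi> p \<in> points V" if "p \<in> points V" for p
  proof -
    have "\<sigma> (Inl p) \<in> ?W'" using onto that W(1) by blast
    then show ?thesis using \<pi> [OF that] W(3) by simp
  qed
  have \<beta>V: "\<beta> b \<in> blocks V E S'" if "b \<in> blocks V E S" for b
  proof -
    have "\<sigma> (Inr b) \<in> ?W'" using onto that W(2) by blast
    then show ?thesis using \<beta> [OF that] W(4) by simp
  qed
  have \<pi>_onto: "\<exists>p\<in>points V. q = \<pi> p" if "q \<in> points V" for q
  proof -
    have "Inl q \<in> \<sigma> ` ?W" using onto that W(3) by blast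
    then obtain x where x: "x \<in> ?W" "\<sigma> x = Inl q" by force
    then obtain p where "x = Inl p" using isl [OF x(1)] by (cases x) auto
    then show ?thesis using x \<pi> W(1) by force
  qed
  have \<beta>_onto: "\<exists>b\<in>blocks V E S. b' = \<beta> b" if "b' \<in> blocks V E S'" for b'
  proof -
    have "Inr b' \<in> \<sigma> ` ?W" using onto that W(4) by blast
    then obtain x where x: "x \<in> ?W" "\<sigma> x = Inr b'" by force
    then obtain b where "x = Inr b" using isl [OF x(1)] by (cases x) auto
    then show ?thesis using x \<beta> W(2) by force
  qed
  have "inj_on \<pi> (points V)"
  proof (rule inj_onI)
    fix p q assume pq: "p \<in> points V" "q \<in> points V" "\<pi> p = \<pi> q"
    then have "\<sigma> (Inl p) = \<sigma> (Inl q)" using \<pi> by simp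
    then have "Inl p = (Inl q :: (nat + 'a) + (nat + 'a) set)" using inj pq(1,2) W(1) by (auto dest: inj_onD)
    then show "p = q" by simp
  qed
  then have bij\<pi>: "bij_betw \<pi> (points V) (points V)" using \<pi>V \<pi>_onto by (auto simp: bij_betw_def)
  have mem: "\<pi> p \<in> \<beta> b \<longleftrightarrow> p \<in> b" if "p \<in> points V" "b \<in> blocks V E S" for p b
    using E [of "Inl p" "Inr b"] that W \<pi>V \<beta>V by (simp add: \<pi> \<beta> block_edges_iff)
  have \<beta>\<pi>: "\<beta> b = \<pi> ` b" if b: "b \<in> blocks V E S" for b
  proof (intro equalityI subsetI)
    fix q assume q: "q \<in> \<beta> b"
    then have "q \<in> points V" using blocks_subset_points [OF gr \<beta>V [OF b]] by blast
    then obtain p where "p \<in> points V" "q = \<pi> p" using \<pi>_onto by blast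
    then show "q \<in> \<pi> ` b" using q mem [OF _ b] by blast
  next
    fix q assume "q \<in> \<pi> ` b"
    then show "q \<in> \<beta> b" using mem [OF _ b] blocks_subset_points [OF gr b] by blast
  qed
  have bl: "(`) \<pi> ` blocks V E S = blocks V E S'"
  proof (intro equalityI subsetI)
    fix b' assume "b' \<in> (`) \<pi> ` blocks V E S"
    then obtain b where b: "b \<in> blocks V E S" "b' = \<pi> ` b" by blast
    then show "b' \<in> blocks V E S'" using \<beta>V [OF b(1)] \<beta>\<pi> [OF b(1)] by simp
  next
    fix b' assume "b' \<in> blocks V E S'"
    then obtain b where b: "b \<in> blocks V E S" "b' = \<beta> b" using \<beta>_onto by blast
    then show "b' \<in> (`) \<pi> ` blocks V E S" using \<beta>\<pi> [OF b(1)] by blast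
  qed
  have "\<forall>b\<in>blocks V E S. \<sigma> (Inr b) = Inr (\<pi> ` b)" using \<beta> \<beta>\<pi> by simp
  moreover have "\<forall>p\<in>points V. \<sigma> (Inl p) = Inl (\<pi> p)" using \<pi> by simp
  ultimately show ?thesis using that [OF bij\<pi> _ _ bl] by simp
qed

text \<open>Cardinality identifies the initial segments, so \<open>\<pi>\<close> preserves each of
  them and fixes every natural. The infinite block is then mapped to itself, which gives
  \<open>S = S'\<close>, and the vertices are left to be permuted among themselves, with edge blocks
  forcing a graph automorphism.\<close>

lemma blocks_rigid:
  assumes gr: "graph V E" and bij: "bij_betw \<pi> (points V) (points V)"
    and bl: "(`) \<pi> ` blocks V E S = blocks V E S'"
  shows "\<pi> (Inl n) = Inl n" and "S = S'"
    and "\<exists>\<gamma>. bij_betw \<gamma> V V \<and> (\<forall>w\<in>V. \<pi> (Inr w) = Inr (\<gamma> w)) \<and>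
      (\<forall>u\<in>V. \<forall>v\<in>V. (u, v) \<in> E \<longleftrightarrow> (\<gamma> u, \<gamma> v) \<in> E)"
proof -
  have inj: "inj_on \<pi> (points V)" and onto: "\<pi> ` points V = points V" using bij by (auto simp: bij_betw_def)
  have P: "Inl n \<in> points V" "Inr w \<in> points V \<longleftrightarrow> w \<in> V" for n w by (auto simp: points_def)
  have \<pi>b: "\<pi> ` b \<in> blocks V E S'" if "b \<in> blocks V E S" for b using bl that by blast
  have sub: "Inl ` X \<subseteq> points V" for X by (auto simp: points_def)
  have card: "card (\<pi> ` Inl ` {..<k}) = k" for k
  proof -
    have "card (\<pi> ` Inl ` {..<k}) = card (Inl ` {..<k} :: (nat + 'a) set)"
      using inj_on_subset [OF inj sub] by (rule card_image)
    also have "\<dots> = k" by (simp add: card_image)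
    finally show ?thesis .
  qed
  have initial: "\<pi> ` Inl ` {..<k} = Inl ` {..<k}" for k
  proof -
    \<comment> \<open>A segment with fewer than three points might be sent to a vertex or edge
      block. Enlarging it to \<open>k + 3\<close> points rules this out, and the smaller segment
      inherits the containment.\<close>
    have "\<pi> ` Inl ` {..<k + 3} \<subseteq> range Inl"
      using \<pi>b [OF initial_in_blocks] card [of "k + 3"] by (intro large_block_subset [of _ V E S']) auto
    then have "\<pi> ` Inl ` {..<k} \<subseteq> range Inl" by (force simp: image_subset_iff)
    then have "\<pi> ` Inl ` {..<k} = Inl ` {..<card (\<pi> ` Inl ` {..<k})}"
      by (intro finite_block_eq_initial [OF \<pi>b [OF initial_in_blocks]]) simp_all
    then show ?thesis unfolding card .
  qed
  show fixes_Inl: "\<pi> (Inl n) = Inl n" for n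
  proof -
    \<comment> \<open>Two consecutive segments are preserved, and they differ in the single point
      \<open>Inl n\<close>.\<close>
    have "\<pi> (Inl n) \<in> \<pi> ` Inl ` {..<Suc n}" by simp
    then have "\<pi> (Inl n) \<in> Inl ` {..<Suc n}" unfolding initial .
    moreover have "\<pi> (Inl n) \<notin> \<pi> ` Inl ` {..<n}"
      using inj_on_image_mem_iff [OF inj P(1) sub, of n "{..<n}"] by auto
    then have "\<pi> (Inl n) \<notin> Inl ` {..<n}" unfolding initial .
    ultimately show ?thesis by (auto simp: less_Suc_eq)
  qed
  show "S = S'"
  proof -
    have "\<pi> ` Inl ` code S = Inl ` code S" by (simp add: image_image fixes_Inl)
    then have "Inl ` code S \<in> blocks V E S'" using \<pi>b [OF code_in_blocks] by simp
    moreover have "infinite (Inl ` code S :: (nat + 'a) set)"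
      using infinite_code finite_imageD [of Inl "code S"] by auto
    ultimately have "(Inl ` code S :: (nat + 'a) set) = Inl ` code S'" by (rule infinite_block_eq_code)
    then have "code S = code S'" by (simp add: inj_image_eq_iff)
    then show ?thesis by (rule code_inj)
  qed
  define \<gamma> where "\<gamma> w = projr (\<pi> (Inr w))" for w
  have \<gamma>: "\<pi> (Inr w) = Inr (\<gamma> w) \<and> \<gamma> w \<in> V" if w: "w \<in> V" for w
  proof (cases "\<pi> (Inr w)")
    case (Inl n)
    then have "\<pi> (Inr w) = \<pi> (Inl n)" using fixes_Inl by simp
    then have "Inr w = (Inl n :: nat + 'a)" using inj P w by (auto dest: inj_onD)
    then show ?thesis by simp
  next
    case (Inr w')
    moreover have "\<pi> (Inr w) \<in> points V" using onto w P(2) by blast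
    ultimately show ?thesis using P(2) by (simp add: \<gamma>_def)
  qed
  have "inj_on \<gamma> V"
  proof (rule inj_onI)
    fix u v assume uv: "u \<in> V" "v \<in> V" "\<gamma> u = \<gamma> v"
    then have "\<pi> (Inr u) = \<pi> (Inr v)" using \<gamma> by simp
    then have "Inr u = (Inr v :: nat + 'a)" using inj P(2) uv(1,2) by (auto dest: inj_onD)
    then show "u = v" by simp
  qed
  moreover have "\<gamma> ` V = V"
  proof (intro equalityI subsetI)
    fix w assume "w \<in> V"
    then have "Inr w \<in> \<pi> ` points V" using onto P(2) by blast
    then obtain p where p: "p \<in> points V" "\<pi> p = Inr w" by force
    then obtain v where "p = Inr v" using fixes_Inl by (cases p) auto
    then show "w \<in> \<gamma> ` V" using p P(2) \<gamma> [of v] by auto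
  qed (use \<gamma> in auto)
  ultimately have bij\<gamma>: "bij_betw \<gamma> V V" by (simp add: bij_betw_def)
  have "(u, v) \<in> E \<longleftrightarrow> (\<gamma> u, \<gamma> v) \<in> E" if uv: "u \<in> V" "v \<in> V" for u v
  proof (cases "u = v")
    case True
    then show ?thesis using gr by (auto simp: graph_def irrefl_def)
  next
    case False
    then have ne: "\<gamma> u \<noteq> \<gamma> v" using bij\<gamma> uv by (auto simp: bij_betw_def dest: inj_onD)
    have im: "\<pi> ` {Inr u, Inr v} = {Inr (\<gamma> u), Inr (\<gamma> v)}" using \<gamma> uv by simp
    have s: "{Inr u, Inr v} \<subseteq> points V" using uv P(2) by simp
    have "{Inr u, Inr v} \<in> blocks V E S \<longleftrightarrow> \<pi> ` {Inr u, Inr v} \<in> blocks V E S'"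
    proof
      assume "\<pi> ` {Inr u, Inr v} \<in> blocks V E S'"
      then obtain b where b: "b \<in> blocks V E S" "\<pi> ` {Inr u, Inr v} = \<pi> ` b" using bl by blast
      then have "{Inr u, Inr v} = b"
        using inj_on_image_eq_iff [OF inj s blocks_subset_points [OF gr b(1)]] by blast
      then show "{Inr u, Inr v} \<in> blocks V E S" using b(1) by simp
    qed (rule \<pi>b)
    then show ?thesis unfolding im pair_block_iff [OF gr False] pair_block_iff [OF gr ne] .
  qed
  then show "\<exists>\<gamma>. bij_betw \<gamma> V V \<and> (\<forall>w\<in>V. \<pi> (Inr w) = Inr (\<gamma> w)) \<and>
      (\<forall>u\<in>V. \<forall>v\<in>V. (u, v) \<in> E \<longleftrightarrow> (\<gamma> u, \<gamma> v) \<in> E)"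
    using bij\<gamma> \<gamma> by blast
qed

text \<open>Serves twice: the conclusion \<open>S = S'\<close> separates the D-classes belonging to
  different sets, and for equal sets the formula shows that every automorphism comes from one of the
  coded graph.\<close>

lemma block_graph_iso_cases:
  assumes gr: "graph V E" and \<sigma>: "bg_iso (block_graph V E S) (block_graph V E S') \<sigma>"
  obtains \<gamma> where "S = S'" "bij_betw \<gamma> V V" "\<forall>u\<in>V. \<forall>v\<in>V. (u, v) \<in> E \<longleftrightarrow> (\<gamma> u, \<gamma> v) \<in> E"
    "\<forall>x\<in>bverts (block_graph V E S). \<sigma> x = map_sum (map_sum id \<gamma>) (image (map_sum id \<gamma>)) x"
proof -
  obtain \<pi> where \<pi>: "bij_betw \<pi> (points V) (points V)" "\<forall>p\<in>points V. \<sigma> (Inl p) = Inl (\<pi> p)"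
    "\<forall>b\<in>blocks V E S. \<sigma> (Inr b) = Inr (\<pi> ` b)" "(`) \<pi> ` blocks V E S = blocks V E S'"
    by (rule block_graph_iso_on_points [OF gr \<sigma>])
  note rigid = blocks_rigid [OF gr \<pi>(1,4)]
  obtain \<gamma> where \<gamma>: "bij_betw \<gamma> V V" "\<forall>w\<in>V. \<pi> (Inr w) = Inr (\<gamma> w)"
    "\<forall>u\<in>V. \<forall>v\<in>V. (u, v) \<in> E \<longleftrightarrow> (\<gamma> u, \<gamma> v) \<in> E" using rigid(3) by blast
  have m: "\<pi> p = map_sum id \<gamma> p" if "p \<in> points V" for p
    using that rigid(1) \<gamma>(2) by (cases p) (auto simp: points_def)
  have lift: "\<sigma> x = map_sum (map_sum id \<gamma>) (image (map_sum id \<gamma>)) x" if x: "x \<in> bverts (block_graph V E S)" for x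
  proof (cases x)
    case (Inl p)
    then show ?thesis using x \<pi>(2) m by (simp add: block_verts_iff)
  next
    case (Inr b)
    then have b: "b \<in> blocks V E S" using x by (simp add: block_verts_iff)
    have "\<pi> ` b = map_sum id \<gamma> ` b" using blocks_subset_points [OF gr b] m by (intro image_cong) auto
    then show ?thesis using \<pi>(3) b Inr by simp
  qed
  show ?thesis by (rule that [OF rigid(2) \<gamma>(1,3)]) (simp add: lift)
qed

section \<open>Lifting automorphisms of the coded graph\<close>

lemma map_sum_point:
  "(\<And>w. w \<in> V \<Longrightarrow> \<gamma> w \<in> V) \<Longrightarrow> p \<in> points V \<Longrightarrow> map_sum id \<gamma> p \<in> points V"
  by (auto simp: points_def)

lemma map_sum_block:
  assumes "\<And>w. w \<in> V \<Longrightarrow> \<gamma> w \<in> V" "\<And>u v. (u, v) \<in> E \<Longrightarrow> (\<gamma> u, \<gamma> v) \<in> E" "b \<in> blocks V E S"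
  shows "map_sum id \<gamma> ` b \<in> blocks V E S"
  using assms(3)
proof (cases rule: blocksE)
  case (initial k)
  then have "map_sum id \<gamma> ` b = Inl ` {..<k}" by (simp add: image_image)
  then show ?thesis using initial_in_blocks by simp
next
  case code
  then have "map_sum id \<gamma> ` b = Inl ` code S" by (simp add: image_image)
  then show ?thesis using code_in_blocks by simp
next
  case (vertex w)
  then show ?thesis using assms(1) by (auto simp: blocks_def)
next
  case (edge u v)
  then show ?thesis using assms(2) by (force simp: blocks_def)
qed

lemma block_graph_lift_iso:
  assumes gr: "graph V E" and bij: "bij_betw \<gamma> V V" and E: "\<forall>u\<in>V. \<forall>v\<in>V. (u, v) \<in> E \<longleftrightarrow> (\<gamma> u, \<gamma> v) \<in> E"
  shows "bg_iso (block_graph V E S) (block_graph V E S) (map_sum (map_sum id \<gamma>) (image (map_sum id \<gamma>)))"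
proof -
  let ?W = "bverts (block_graph V E S)"
  \<comment> \<open>Keeping the map as a parameter lets one set of facts cover both
    \<open>\<gamma>\<close> and its inverse \<open>\<delta>\<close>; \<open>L \<delta>\<close> then
    inverts \<open>L \<gamma>\<close> on the vertices.\<close>
  define L where "L \<alpha> = map_sum (map_sum id \<alpha> :: nat + 'a \<Rightarrow> nat + 'a) (image (map_sum id \<alpha> :: nat + 'a \<Rightarrow> nat + 'a))" for \<alpha>
  define \<delta> where "\<delta> = inv_into V \<gamma>"
  have EV: "E \<subseteq> V \<times> V" using gr by (simp add: graph_def)
  have \<gamma>: "\<gamma> w \<in> V" "\<delta> w \<in> V" "\<delta> (\<gamma> w) = w" "\<gamma> (\<delta> w) = w" if "w \<in> V" for w
    using bij that by (auto simp: \<delta>_def bij_betw_inv_into_right bij_betw_def intro: inv_into_into)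
  have \<gamma>E: "(\<gamma> u, \<gamma> v) \<in> E" if "(u, v) \<in> E" for u v using E EV that by blast
  have \<delta>E: "(\<delta> u, \<delta> v) \<in> E" if uv: "(u, v) \<in> E" for u v
  proof -
    have V: "u \<in> V" "v \<in> V" using EV uv by auto
    then have "(\<gamma> (\<delta> u), \<gamma> (\<delta> v)) \<in> E" using uv \<gamma>(4) by simp
    then show ?thesis using E \<gamma>(2) V by blast
  qed
  have LW: "L \<alpha> x \<in> ?W"
    if "\<And>w. w \<in> V \<Longrightarrow> \<alpha> w \<in> V" "\<And>u v. (u, v) \<in> E \<Longrightarrow> (\<alpha> u, \<alpha> v) \<in> E" "x \<in> ?W" for \<alpha> x
    using that(3) map_sum_point [OF that(1)] map_sum_block [OF that(1,2)]
    by (cases x) (auto simp: L_def block_verts_iff)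
  have mm: "map_sum id \<beta> (map_sum id \<alpha> p) = p" if "\<And>w. w \<in> V \<Longrightarrow> \<beta> (\<alpha> w) = w" "p \<in> points V"
    for \<alpha> \<beta> and p :: "nat + 'a" using that by (auto simp: points_def)
  have LL: "L \<beta> (L \<alpha> x) = x" if inv: "\<And>w. w \<in> V \<Longrightarrow> \<beta> (\<alpha> w) = w" and x: "x \<in> ?W" for \<alpha> \<beta> x
  proof (cases x)
    case (Inl p)
    then show ?thesis using mm [of \<beta> \<alpha>, OF inv] x by (simp add: L_def block_verts_iff)
  next
    case (Inr b)
    then have b: "b \<subseteq> points V" using x blocks_subset_points [OF gr] by (simp add: block_verts_iff)
    have "map_sum id \<beta> ` map_sum id \<alpha> ` b = (\<lambda>p. p) ` b"
      unfolding image_image using mm [of \<beta> \<alpha>, OF inv] b by (intro image_cong) auto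
    then show ?thesis using Inr by (simp add: L_def)
  qed
  have "bg_iso (block_graph V E S) (block_graph V E S) (L \<gamma>)"
    unfolding bg_iso_iff [OF bipartite_block_graph bipartite_block_graph]
  proof (intro conjI ballI)
    show "bij_betw (L \<gamma>) ?W ?W"
      using LW [of \<gamma>] LW [of \<delta>] LL [of \<delta> \<gamma>] LL [of \<gamma> \<delta>] \<gamma> \<gamma>E \<delta>E
      by (intro bij_betw_byWitness [of _ "L \<delta>"] ballI image_subsetI) blast+
  next
    fix x y assume xy: "x \<in> ?W" "y \<in> ?W"
    have isl: "isl (L \<gamma> z) = isl z" for z by (cases z) (simp_all add: L_def)
    show "(L \<gamma> x, L \<gamma> y) \<in> bpart (block_graph V E S) \<longleftrightarrow> (x, y) \<in> bpart (block_graph V E S)"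
      using xy LW [OF \<gamma>(1) \<gamma>E] isl unfolding block_graph_sel(3) by simp
    have inj: "inj_on (map_sum id \<gamma>) (points V)"
      using mm [of \<delta> \<gamma>] \<gamma>(3) by (intro inj_on_inverseI [of _ "map_sum id \<delta>"]) blast
    have mem: "map_sum id \<gamma> p \<in> map_sum id \<gamma> ` b \<longleftrightarrow> p \<in> b" if "p \<in> points V" "b \<in> blocks V E S" for p b
      using inj_on_image_mem_iff [OF inj that(1) blocks_subset_points [OF gr that(2)]] .
    have mp: "map_sum id \<gamma> p \<in> points V" if "p \<in> points V" for p
      using map_sum_point [OF \<gamma>(1) that] .
    have mb: "map_sum id \<gamma> ` b \<in> blocks V E S" if "b \<in> blocks V E S" for b
      using map_sum_block [OF \<gamma>(1) \<gamma>E that] .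
    show "(L \<gamma> x, L \<gamma> y) \<in> bedges (block_graph V E S) \<longleftrightarrow> (x, y) \<in> bedges (block_graph V E S)"
      using xy mem mp mb
      by (cases x; cases y) (simp_all add: L_def block_graph_sel(2) block_edges_iff block_verts_iff)
  qed
  then show ?thesis by (simp add: L_def)
qed

text \<open>The map \<open>F\<close> reads off the action on the points that represent vertices.
  Rigidity makes it injective, since this action determines the whole automorphism; lifting makes it
  surjective.\<close>

lemma Aut_block_graph:
  assumes gr: "graph V E"
  shows "bg_Aut (block_graph V E S) \<cong> Aut_graph V E"
proof -
  let ?W = "bverts (block_graph V E S)"
  define F where "F \<sigma> = (\<lambda>w\<in>V. projr (projl (\<sigma> (Inl (Inr w) :: (nat + 'a) + (nat + 'a) set) :: (nat + 'a) + (nat + 'a) set)))" for \<sigma>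
  have V: "Inl (Inr w) \<in> ?W" if "w \<in> V" for w using that by (simp add: block_verts_iff points_def)
  have key: "\<exists>\<gamma>. bij_betw \<gamma> V V \<and> (\<forall>u\<in>V. \<forall>v\<in>V. (u, v) \<in> E \<longleftrightarrow> (\<gamma> u, \<gamma> v) \<in> E) \<and>
      (\<forall>x\<in>?W. \<sigma> x = map_sum (map_sum id \<gamma>) (image (map_sum id \<gamma>)) x) \<and> (\<forall>w\<in>V. F \<sigma> w = \<gamma> w)"
    if \<sigma>: "\<sigma> \<in> carrier (bg_Aut (block_graph V E S))" for \<sigma>
  proof -
    have "bg_iso (block_graph V E S) (block_graph V E S) \<sigma>" using \<sigma> by (simp add: bg_Aut_def)
    then obtain \<gamma> where \<gamma>: "bij_betw \<gamma> V V" "\<forall>u\<in>V. \<forall>v\<in>V. (u, v) \<in> E \<longleftrightarrow> (\<gamma> u, \<gamma> v) \<in> E"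
      "\<forall>x\<in>?W. \<sigma> x = map_sum (map_sum id \<gamma>) (image (map_sum id \<gamma>)) x"
      by (rule block_graph_iso_cases [OF gr])
    have "F \<sigma> w = \<gamma> w" if "w \<in> V" for w using \<gamma>(3) V [OF that] that by (simp add: F_def)
    then show ?thesis using \<gamma> by blast
  qed
  have F_Aut: "F \<sigma> \<in> carrier (Aut_graph V E)" if \<sigma>: "\<sigma> \<in> carrier (bg_Aut (block_graph V E S))" for \<sigma>
  proof -
    obtain \<gamma> where \<gamma>: "bij_betw \<gamma> V V" "\<forall>u\<in>V. \<forall>v\<in>V. (u, v) \<in> E \<longleftrightarrow> (\<gamma> u, \<gamma> v) \<in> E" "\<forall>w\<in>V. F \<sigma> w = \<gamma> w"
      using key [OF \<sigma>] by blast
    have "bij_betw (F \<sigma>) V V" using \<gamma>(1,3) bij_betw_cong [of V "F \<sigma>" \<gamma>] by blast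
    moreover have "F \<sigma> \<in> extensional V" by (simp add: F_def)
    ultimately show ?thesis using \<gamma>(2,3) by (simp add: Aut_graph_def Bij_def)
  qed
  have "F \<in> hom (bg_Aut (block_graph V E S)) (Aut_graph V E)"
    unfolding hom_def
  proof (intro CollectI conjI ballI)
    show "F \<in> carrier (bg_Aut (block_graph V E S)) \<rightarrow> carrier (Aut_graph V E)" using F_Aut by blast
    fix \<sigma> \<tau> assume s: "\<sigma> \<in> carrier (bg_Aut (block_graph V E S))" "\<tau> \<in> carrier (bg_Aut (block_graph V E S))"
    obtain \<gamma> where \<gamma>: "bij_betw \<gamma> V V" "\<forall>x\<in>?W. \<sigma> x = map_sum (map_sum id \<gamma>) (image (map_sum id \<gamma>)) x"
      "\<forall>w\<in>V. F \<sigma> w = \<gamma> w" using key [OF s(1)] by blast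
    have "F (\<sigma> \<otimes>\<^bsub>bg_Aut (block_graph V E S)\<^esub> \<tau>) w = (F \<sigma> \<otimes>\<^bsub>Aut_graph V E\<^esub> F \<tau>) w" if w: "w \<in> V" for w
    proof -
      have "\<gamma> w \<in> V" using \<gamma>(1) w by (auto simp: bij_betw_def)
      moreover have "\<sigma> (Inl (Inr w)) = Inl (Inr (\<gamma> w))" using \<gamma>(2) V [OF w] by simp
      ultimately show ?thesis using w V [OF w] \<gamma>(3)
        by (simp add: bg_Aut_def Aut_graph_def compose_eq) (simp add: F_def compose_eq)
    qed
    then show "F (\<sigma> \<otimes>\<^bsub>bg_Aut (block_graph V E S)\<^esub> \<tau>) = F \<sigma> \<otimes>\<^bsub>Aut_graph V E\<^esub> F \<tau>"
      by (intro extensionalityI [of _ V]) (simp_all add: F_def Aut_graph_def)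
  qed
  moreover have "inj_on F (carrier (bg_Aut (block_graph V E S)))"
  proof (rule inj_onI)
    fix \<sigma> \<tau> assume s: "\<sigma> \<in> carrier (bg_Aut (block_graph V E S))" "\<tau> \<in> carrier (bg_Aut (block_graph V E S))"
      and eq: "F \<sigma> = F \<tau>"
    obtain \<gamma> where \<gamma>: "\<forall>x\<in>?W. \<sigma> x = map_sum (map_sum id \<gamma>) (image (map_sum id \<gamma>)) x" "\<forall>w\<in>V. F \<sigma> w = \<gamma> w"
      using key [OF s(1)] by blast
    obtain \<delta> where \<delta>: "\<forall>x\<in>?W. \<tau> x = map_sum (map_sum id \<delta>) (image (map_sum id \<delta>)) x" "\<forall>w\<in>V. F \<tau> w = \<delta> w"
      using key [OF s(2)] by blast
    have m: "map_sum id \<gamma> p = map_sum id \<delta> p" if "p \<in> points V" for p :: "nat + 'a"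
      using that \<gamma>(2) \<delta>(2) eq by (auto simp: points_def)
    have "map_sum (map_sum id \<gamma>) (image (map_sum id \<gamma>)) x = map_sum (map_sum id \<delta>) (image (map_sum id \<delta>)) x"
      if x: "x \<in> ?W" for x
    proof (cases x)
      case (Inl p)
      then show ?thesis using x m by (simp add: block_verts_iff)
    next
      case (Inr b)
      then have "b \<subseteq> points V" using x blocks_subset_points [OF gr] by (simp add: block_verts_iff)
      then have "map_sum id \<gamma> ` b = map_sum id \<delta> ` b" using m by (intro image_cong) auto
      then show ?thesis using Inr by simp
    qed
    then show "\<sigma> = \<tau>"
      using s \<gamma>(1) \<delta>(1) by (intro extensionalityI [of _ ?W]) (simp_all add: bg_Aut_def)
  qed
  moreover have "\<gamma> \<in> F ` carrier (bg_Aut (block_graph V E S))" if "\<gamma> \<in> carrier (Aut_graph V E)" for \<gamma>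
  proof -
    have \<gamma>: "\<gamma> \<in> extensional V" "bij_betw \<gamma> V V" "\<forall>u\<in>V. \<forall>v\<in>V. (u, v) \<in> E \<longleftrightarrow> (\<gamma> u, \<gamma> v) \<in> E"
      using that by (simp_all add: Aut_graph_def Bij_def)
    define \<sigma> where "\<sigma> = restrict (map_sum (map_sum id \<gamma>) (image (map_sum id \<gamma> :: nat + 'a \<Rightarrow> nat + 'a))) ?W"
    have "bg_iso (block_graph V E S) (block_graph V E S) \<sigma>"
      using block_graph_lift_iso [OF gr \<gamma>(2,3), of S]
      unfolding bg_iso_iff [OF bipartite_block_graph bipartite_block_graph] \<sigma>_def
      by (simp add: bij_betw_restrict_eq)
    then have "\<sigma> \<in> carrier (bg_Aut (block_graph V E S))" by (simp add: bg_Aut_def \<sigma>_def)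
    moreover have "\<gamma> = F \<sigma>"
    proof (rule extensionalityI [OF \<gamma>(1)])
      fix w assume w: "w \<in> V"
      then show "\<gamma> w = F \<sigma> w" using V [OF w] by (simp add: F_def \<sigma>_def)
    qed (simp add: F_def)
    ultimately show ?thesis by blast
  qed
  ultimately have "F \<in> iso (bg_Aut (block_graph V E S)) (Aut_graph V E)"
    using F_Aut by (auto simp: iso_def bij_betw_def)
  then show ?thesis by (auto simp: is_iso_def)
qed

section \<open>Counting classes\<close>

context universal_bg
begin

interpretation End: monoid "bg_End B" by (rule monoid_End)

text \<open>All idempotents of one D-class have isomorphic images, so a single copy \<open>A\<close>
  describes every group in the class.\<close>

lemma H_class_group_in_D_class:
  assumes A: "bipartite_graph A" and e: "e \<in> idempotents (bg_End B)"
    and iso: "bg_isomorphic A (bg_image B e)"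
    and H: "H \<in> group_H_classes_in (bg_End B) (green_D (bg_End B) `` {e})"
  shows "H_class_group (bg_End B) H \<cong> bg_Aut A"
proof -
  obtain f where f: "f \<in> idempotents (bg_End B)" "H = green_H (bg_End B) `` {f}"
    "H \<subseteq> green_D (bg_End B) `` {e}"
    using H unfolding group_H_classes_in_def by blast
  have "f \<in> H" using f(1) equiv_class_self [OF End.equiv_green_H] unfolding f(2) by (simp add: idempotents_def)
  then have "(e, f) \<in> green_D (bg_End B)" using f(3) by blast
  then have "bg_isomorphic (bg_image B e) (bg_image B f)"
    using green_D_idempotents_iff_isomorphic [OF e f(1)] by blast
  then have "bg_isomorphic A (bg_image B f)"
    using bg_isomorphic_trans [OF A bipartite_idempotent_image [OF e] bipartite_idempotent_image [OF f(1)] iso]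
    by blast
  then obtain \<psi> where "bg_iso A (bg_image B f) \<psi>" by (auto simp: bg_isomorphic_def)
  then show ?thesis unfolding f(2) by (rule H_class_group_iso_Aut [OF f(1) A])
qed

lemma D_classes_lepoll: "D_classes (bg_End B) \<lesssim> (UNIV :: nat set set)"
proof -
  have "D_classes (bg_End B) = (\<lambda>f. green_D (bg_End B) `` {f}) ` carrier (bg_End B)"
    unfolding D_classes_def quotient_def by blast
  then have "D_classes (bg_End B) \<lesssim> carrier (bg_End B)" by (simp add: image_lepoll)
  then show ?thesis using End_lepoll by (rule lepoll_trans)
qed

lemma regular_D_classes_with_group:
  fixes V :: "'w set"
  assumes gr: "Defs.graph V E" and cnt: "countable V"
  shows "{D \<in> regular_D_classes (bg_End B).
     \<forall>H \<in> group_H_classes_in (bg_End B) D. H_class_group (bg_End B) H \<cong> Aut_graph V E}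
     \<approx> (UNIV :: nat set set)" (is "?R \<approx> _")
proof -
  have "\<exists>e\<in>idempotents (bg_End B). bg_isomorphic (block_graph V E S) (bg_image B e)" for S
  proof -
    \<comment> \<open>The naturals are points for every \<open>V\<close>, so the two vertices of one
      colour that serve as retraction targets exist even when \<open>V\<close> is empty.\<close>
    have "\<exists>e :: nat set \<Rightarrow> 'v \<Rightarrow> 'v. inj e \<and>
      (\<forall>S'. e S' \<in> idempotents (bg_End B) \<and> bg_isomorphic (block_graph V E S) (bg_image B (e S')))"
      by (rule idempotents_with_image [of _ isl "Inl (Inl 0)" "Inl (Inl 1)"])
        (simp_all add: countable_block_graph [OF gr cnt] graph_block_graph block_graph_sel(3)
          block_edges_colours finitely_dominated_block_graph block_verts_iff points_def)
    then show ?thesis by blast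
  qed
  then obtain e where e: "\<And>S. e S \<in> idempotents (bg_End B)"
    "\<And>S. bg_isomorphic (block_graph V E S) (bg_image B (e S))" by metis
  have ec: "e S \<in> carrier (bg_End B)" for S using e(1) [of S] by (simp add: idempotents_def)
  let ?D = "\<lambda>S. green_D (bg_End B) `` {e S}"
  have "?D S \<in> ?R" for S
  proof -
    have "?D S \<in> D_classes (bg_End B)" unfolding D_classes_def using ec by (rule quotientI)
    then have "?D S \<in> regular_D_classes (bg_End B)"
      unfolding regular_D_classes_def using End.green_D_idempotent_regular [OF e(1)] by blast
    moreover have "H_class_group (bg_End B) H \<cong> Aut_graph V E"
      if "H \<in> group_H_classes_in (bg_End B) (?D S)" for H
      using H_class_group_in_D_class [OF bipartite_block_graph e that] Aut_block_graph [OF gr]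
      by (rule iso_trans)
    ultimately show ?thesis by blast
  qed
  moreover have "inj ?D"
  proof (rule injI)
    fix S S' assume "?D S = ?D S'"
    then have "(e S, e S') \<in> green_D (bg_End B)" using ec by (rule eq_equiv_class [OF _ End.equiv_green_D])
    then have "bg_isomorphic (bg_image B (e S)) (bg_image B (e S'))"
      using green_D_idempotents_iff_isomorphic [OF e(1) e(1)] by blast
    then have "bg_isomorphic (block_graph V E S) (bg_image B (e S'))"
      using bg_isomorphic_trans [OF bipartite_block_graph bipartite_idempotent_image [OF e(1)]
        bipartite_idempotent_image [OF e(1)] e(2)] by blast
    moreover have "bg_isomorphic (bg_image B (e S')) (block_graph V E S')"
      using bg_isomorphic_sym [OF bipartite_block_graph bipartite_idempotent_image [OF e(1)] e(2)] .
    ultimately have "bg_isomorphic (block_graph V E S) (block_graph V E S')"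
      by (rule bg_isomorphic_trans [OF bipartite_block_graph bipartite_idempotent_image [OF e(1)]
        bipartite_block_graph])
    then obtain \<sigma> where \<sigma>: "bg_iso (block_graph V E S) (block_graph V E S') \<sigma>" by (auto simp: bg_isomorphic_def)
    show "S = S'" by (rule block_graph_iso_cases [OF gr \<sigma>])
  qed
  ultimately have "(UNIV :: nat set set) \<lesssim> ?R" unfolding lepoll_def by blast
  moreover have "?R \<subseteq> D_classes (bg_End B)" unfolding regular_D_classes_def by blast
  then have "?R \<lesssim> (UNIV :: nat set set)"
    using D_classes_lepoll by (meson lepoll_trans subset_imp_lepoll)
  ultimately show ?thesis by (rule lepoll_antisym [rotated])
qed

section \<open>The D-class of the idempotents with image \<open>K11\<close>\<close>

lemma K11_D_class:
  "\<exists>e. e \<in> idempotents (bg_End B) \<and> bg_isomorphic (bg_image B e) K11 \<and>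
     {f \<in> idempotents (bg_End B). bg_isomorphic (bg_image B f) K11} =
     {f \<in> idempotents (bg_End B). (e, f) \<in> green_D (bg_End B)}"
proof -
  obtain u where u: "u \<in> bverts B" using extension [of "{}" "{}" True] by auto
  obtain v where v: "(v, u) \<in> bedges B" using extension [of "{u}" "{}" "c u"] u by auto
  obtain e where e: "e \<in> idempotents (bg_End B)" "bg_isomorphic (bg_image B e) K11"
    by (rule K11_idempotent_of_edge [OF v])
  have "bg_isomorphic (bg_image B f) K11 \<longleftrightarrow> (e, f) \<in> green_D (bg_End B)"
    if f: "f \<in> idempotents (bg_End B)" for f
  proof -
    have b: "bipartite_graph (bg_image B e)" "bipartite_graph (bg_image B f)"
      using bipartite_idempotent_image e f by auto
    note K = bipartite_graph_K11
    show ?thesis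
      unfolding green_D_idempotents_iff_isomorphic [OF e(1) f]
    proof
      assume "bg_isomorphic (bg_image B f) K11"
      then show "bg_isomorphic (bg_image B e) (bg_image B f)"
        using bg_isomorphic_trans [OF b(1) K b(2) e(2)] bg_isomorphic_sym [OF b(2) K] by blast
    next
      assume "bg_isomorphic (bg_image B e) (bg_image B f)"
      then have "bg_isomorphic (bg_image B f) (bg_image B e)" by (rule bg_isomorphic_sym [OF b])
      then show "bg_isomorphic (bg_image B f) K11" using e(2) by (rule bg_isomorphic_trans [OF b(2,1) K])
    qed
  qed
  then show ?thesis using e by blast
qed

text \<open>The idempotent \<open>e\<close> makes the inclusion nonvacuous: any D-class satisfying
  it contains \<open>e\<close> and hence is the class of \<open>e\<close>.\<close>

lemma D_class_of_K11_iff: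
  assumes e: "e \<in> idempotents (bg_End B)" "bg_isomorphic (bg_image B e) K11"
    and K: "{f \<in> idempotents (bg_End B). bg_isomorphic (bg_image B f) K11} =
     {f \<in> idempotents (bg_End B). (e, f) \<in> green_D (bg_End B)}"
  shows "D \<in> D_classes (bg_End B) \<and>
     {f \<in> idempotents (bg_End B). bg_isomorphic (bg_image B f) K11} \<subseteq> D \<longleftrightarrow>
     D = green_D (bg_End B) `` {e}"
proof
  assume D: "D \<in> D_classes (bg_End B) \<and>
     {f \<in> idempotents (bg_End B). bg_isomorphic (bg_image B f) K11} \<subseteq> D"
  then have "e \<in> D" using e by blast
  moreover obtain a where a: "D = green_D (bg_End B) `` {a}"
    using D unfolding D_classes_def by (blast elim: quotientE)
  ultimately have "(a, e) \<in> green_D (bg_End B)" by blast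
  then show "D = green_D (bg_End B) `` {e}" unfolding a by (rule equiv_class_eq [OF End.equiv_green_D])
next
  have ec: "e \<in> carrier (bg_End B)" using e(1) by (simp add: idempotents_def)
  assume D: "D = green_D (bg_End B) `` {e}"
  have "D \<in> D_classes (bg_End B)" unfolding D D_classes_def using ec by (rule quotientI)
  moreover have "{f \<in> idempotents (bg_End B). bg_isomorphic (bg_image B f) K11} \<subseteq> D"
    unfolding K D by blast
  ultimately show "D \<in> D_classes (bg_End B) \<and>
     {f \<in> idempotents (bg_End B). bg_isomorphic (bg_image B f) K11} \<subseteq> D" by blast
qed

lemma K11_D_class_groups:
  assumes e: "e \<in> idempotents (bg_End B)" "bg_isomorphic (bg_image B e) K11"
    and K: "{f \<in> idempotents (bg_End B). bg_isomorphic (bg_image B f) K11} =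
     {f \<in> idempotents (bg_End B). (e, f) \<in> green_D (bg_End B)}"
  shows "group_H_classes_in (bg_End B) (green_D (bg_End B) `` {e}) \<approx> (UNIV :: nat set)"
    and "H \<in> group_H_classes_in (bg_End B) (green_D (bg_End B) `` {e}) \<Longrightarrow>
      H_class_group (bg_End B) H \<cong> integer_mod_group 2"
proof -
  have "e \<in> carrier (bg_End B)" using e(1) by (simp add: idempotents_def)
  from End.group_H_classes_in_green_D [OF this]
  show "group_H_classes_in (bg_End B) (green_D (bg_End B) `` {e}) \<approx> (UNIV :: nat set)"
    unfolding K [symmetric] using K11_idempotents_eqpoll by (rule eqpoll_trans)
  assume H: "H \<in> group_H_classes_in (bg_End B) (green_D (bg_End B) `` {e})"
  have "bg_isomorphic K11 (bg_image B e)"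
    using bg_isomorphic_sym [OF bipartite_idempotent_image [OF e(1)] bipartite_graph_K11 e(2)] .
  from H_class_group_in_D_class [OF bipartite_graph_K11 e(1) this H] bg_Aut_K11
  show "H_class_group (bg_End B) H \<cong> integer_mod_group 2" by (rule iso_trans)
qed

end

theorem theorem5p7:
  fixes B :: "'v bgraph"
  assumes "universal_bipartite_graph B"
  shows
    "(\<forall>(V :: 'w set) E. graph V E \<and> countable V \<longrightarrow>
        {D \<in> regular_D_classes (bg_End B).
           \<forall>H \<in> group_H_classes_in (bg_End B) D. H_class_group (bg_End B) H \<cong> Aut_graph V E}
        \<approx> (UNIV :: nat set set)) \<and>
     (\<forall>f \<in> idempotents (bg_End B). \<not> bg_isomorphic (bg_image B f) K11 \<longrightarrow>
        group_H_classes_in (bg_End B) (green_D (bg_End B) `` {f}) \<approx> (UNIV :: nat set set)) \<and>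
     (\<exists>!D. D \<in> D_classes (bg_End B) \<and>
        {f \<in> idempotents (bg_End B). bg_isomorphic (bg_image B f) K11} \<subseteq> D) \<and>
     (\<forall>D \<in> D_classes (bg_End B).
        {f \<in> idempotents (bg_End B). bg_isomorphic (bg_image B f) K11} \<subseteq> D \<longrightarrow>
        group_H_classes_in (bg_End B) D \<approx> (UNIV :: nat set) \<and>
        (\<forall>H \<in> group_H_classes_in (bg_End B) D.
           H_class_group (bg_End B) H \<cong> integer_mod_group 2))"
proof -
  obtain c where "universal_bg B c" using universal_bipartite_graph_imp_universal_bg [OF assms] by blast
  then interpret universal_bg B c .
  obtain e where e: "e \<in> idempotents (bg_End B)" "bg_isomorphic (bg_image B e) K11"
    and K: "{f \<in> idempotents (bg_End B). bg_isomorphic (bg_image B f) K11} =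
     {f \<in> idempotents (bg_End B). (e, f) \<in> green_D (bg_End B)}"
    using K11_D_class by blast
  note D_iff = D_class_of_K11_iff [OF e K]
  show ?thesis
  proof (intro conjI allI ballI impI)
    show "\<exists>!D. D \<in> D_classes (bg_End B) \<and>
        {f \<in> idempotents (bg_End B). bg_isomorphic (bg_image B f) K11} \<subseteq> D"
      unfolding D_iff by simp
  next
    fix D assume "D \<in> D_classes (bg_End B)"
      "{f \<in> idempotents (bg_End B). bg_isomorphic (bg_image B f) K11} \<subseteq> D"
    then have D: "D = green_D (bg_End B) `` {e}" using D_iff by blast
    show "group_H_classes_in (bg_End B) D \<approx> (UNIV :: nat set)"
      unfolding D by (rule K11_D_class_groups(1) [OF e K])
    show "H_class_group (bg_End B) H \<cong> integer_mod_group 2" if "H \<in> group_H_classes_in (bg_End B) D" for H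
      using that unfolding D by (rule K11_D_class_groups(2) [OF e K])
  qed (use regular_D_classes_with_group green_D_class_eqpoll in blast)+
qed

end
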